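(* Let $X$ be a separable Banach space and let $f:X\to\mathbb{R}$ be even, quasiconvex and densely continuous. Then $f$ is continuous and Gâteaux differentiable on a dense subset of $X$. If $X$ is reflexive, $f$ is continuous and Gâteaux differentiable on $X$ except at the points of a Haar null set.
   Context: Banach spaces are real. A function $f:X\to\mathbb{R}$ is quasiconvex if $f(\lambda x+(1-\lambda)y)\le\max\{f(x),f(y)\}$ for all $x,y\in X$ and $\lambda\in[0,1]$; it is even if $f(-x)=f(x)$ for all $x$. It is densely continuous if it is continuous at the points of a dense subset of $X$. $f$ is Gâteaux differentiable at $x$ with derivative $Df(x)\in X^*$ if $Df(x)h=\lim_{t\to0}\frac{f(x+th)-f(x)}{t}$ for every $h\in X$. "Continuous and Gâteaux differentiable on a set" means that both properties hold at each point of that set, as a function on $X$. A Borel set $E\subset X$ is Haar null if there is a Borel probability measure $\mu$ on $X$ with $\mu(x+E)=0$ for every $x\in X$. "A property holds on $X$ except at the points of a Haar null set" means that there is a Haar null set $N$ such that the property holds at every point of $X\setminus N$. *)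

theory Defs
  imports "HOL-Probability.Probability"
begin

definition quasiconvex :: "('a::real_vector \<Rightarrow> real) \<Rightarrow> bool" where
  "quasiconvex f \<longleftrightarrow>
     (\<forall>x y. \<forall>l\<in>{0..1}. f (l *\<^sub>R x + (1 - l) *\<^sub>R y) \<le> max (f x) (f y))"

definition even_function :: "('a::real_vector \<Rightarrow> real) \<Rightarrow> bool" where
  "even_function f \<longleftrightarrow> (\<forall>x. f (- x) = f x)"

definition holds_densely :: "('a::topological_space \<Rightarrow> bool) \<Rightarrow> bool" where
  "holds_densely P \<longleftrightarrow> (\<exists>D. closure D = UNIV \<and> (\<forall>x\<in>D. P x))"

definition densely_continuous :: "('a::t2_space \<Rightarrow> real) \<Rightarrow> bool" where
  "densely_continuous f \<longleftrightarrow> holds_densely (isCont f)"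

(* The derivative is an element of the continuous dual, i.e. a bounded linear functional. *)
definition has_gateaux_derivative ::
    "('a::real_normed_vector \<Rightarrow> real) \<Rightarrow> ('a \<Rightarrow>\<^sub>L real) \<Rightarrow> 'a \<Rightarrow> bool" where
  "has_gateaux_derivative f D x \<longleftrightarrow>
     (\<forall>h. ((\<lambda>t::real. (f (x + t *\<^sub>R h) - f x) / t) \<longlongrightarrow> blinfun_apply D h) (at 0))"

definition gateaux_differentiable_at :: "('a::real_normed_vector \<Rightarrow> real) \<Rightarrow> 'a \<Rightarrow> bool" where
  "gateaux_differentiable_at f x \<longleftrightarrow> (\<exists>D. has_gateaux_derivative f D x)"

definition haar_null :: "'a::real_normed_vector set \<Rightarrow> bool" where
  "haar_null E \<longleftrightarrow> E \<in> sets borel \<and>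
     (\<exists>M::'a measure. prob_space M \<and> sets M = sets borel \<and>
        (\<forall>x. emeasure M ((\<lambda>e. x + e) ` E) = 0))"

definition holds_except_haar_null :: "('a::real_normed_vector \<Rightarrow> bool) \<Rightarrow> bool" where
  "holds_except_haar_null P \<longleftrightarrow> (\<exists>N. haar_null N \<and> (\<forall>x. x \<notin> N \<longrightarrow> P x))"

definition bidual_embedding :: "'a::real_normed_vector \<Rightarrow> (('a \<Rightarrow>\<^sub>L real) \<Rightarrow>\<^sub>L real)" where
  "bidual_embedding x = Blinfun (\<lambda>g. blinfun_apply g x)"

(* Blinfun is meaningful only on bounded linear maps, which evaluation at x is. *)
lemma bidual_embedding_apply [simp]:
  "blinfun_apply (bidual_embedding x) g = blinfun_apply g x"
  unfolding bidual_embedding_def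
  by (simp add: bounded_linear_Blinfun_apply blinfun.bounded_linear_left)

definition reflexive_space :: "'a::real_normed_vector itself \<Rightarrow> bool" where
  "reflexive_space _ \<longleftrightarrow> surj (bidual_embedding :: 'a \<Rightarrow> _)"

end

theory Submission
  imports Defs
begin

text \<open>
  Evenness and quasiconvexity make every strict sublevel set of \<open>f\<close> absolutely convex.  Let \<open>m\<close>
  be the infimum of \<open>f\<close> over its points of continuity.  Above level \<open>m\<close> the sublevel sets contain
  a ball around \<open>0\<close>; below level \<open>m\<close> they are nowhere dense, since an interior point of
  the closure could be taken to be a point of continuity with a value below \<open>m\<close>.  Let \<open>C\<close> be the
  intersection of the closures of the sublevel sets above level \<open>m\<close>, a closed absolutely convex set.

  Outside \<open>C\<close> a point \<open>y\<close> lies at positive distance from some sublevel set that contains a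
  ball around \<open>0\<close>.  Quasiconvexity on segments that start in this ball and pass through \<open>y\<close> shows
  that \<open>f\<close> does not decrease from \<open>y\<close> in any direction close to \<open>y\<close>: locally, \<open>f\<close> is monotone along
  an open cone.  Such a function is pointwise Lipschitz wherever its restriction to a line in the
  cone has finite upper derivates, which for a monotone function of one variable is almost everywhere.
  Near a set of points where it is uniformly pointwise Lipschitz, a function is squeezed between two
  Lipschitz functions that agree with it on this set (Maly's proof of Stepanov's theorem).
  So almost everywhere differentiability reduces to Lipschitz functions
  (\<open>lipschitz_gateaux_differentiable\<close>, \<open>stepanov_gateaux\<close>, \<open>cone_monotone_gateaux\<close>).

  Inside \<open>C\<close> there are two cases.  If \<open>C\<close> has empty interior, then by Baire's theorem its multiples
  fill only a proper subspace, which a line in a direction outside the subspace meets at most once.  If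
  \<open>C\<close> has interior points, then its boundary is negligible, and in its interior \<open>f \<le> m\<close>; the points
  with \<open>f < m\<close> lie in a countable union of nowhere dense absolutely convex sets, whose linear
  hull \<open>Y\<close> is again a proper subspace.  From a point of the interior of \<open>C\<close> outside \<open>Y\<close> every line
  meets \<open>Y\<close> at most once, so \<open>f\<close> equals \<open>m\<close> on a neighbourhood of the point in the line: the
  derivative is \<open>0\<close>.  Continuity at such a point holds because each single sublevel set below \<open>m\<close>
  stays away from it.

  All exceptional sets are covered by countably many Borel sets, each Lebesgue null on every line
  parallel to one of countably many fixed directions \<open>d i\<close>.  The law of a random series
  \<open>\<Sum>i. c i * U i * d i\<close> with independent uniform \<open>U i\<close> is a probability measure that
  gives mass \<open>0\<close> to all translates of such a set, by Fubini's theorem in one coordinate at a time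
  (\<open>dir_null_imp_haar_null\<close>).  In a separable space the complement of a Haar null set is dense.
\<close>

section \<open>Lipschitz and monotone functions of one real variable\<close>

lemma ex_inverse_nat_less: "0 < e \<Longrightarrow> \<exists>n::nat. 1 / (real n + 1) < e"
  by (metis Suc_eq_plus1 inverse_eq_divide of_nat_Suc reals_Archimedean add.commute of_nat_1 of_nat_add)

lemma disjoint_cballs_real:
  fixes a b r s :: real
  assumes "disjnt (cball a r) (cball b s)" "0 < r" "0 < s"
  shows "a + r < b - s \<or> b + s < a - r"
proof (rule ccontr)
  assume "\<not> ?thesis"
  then have "max (a - r) (b - s) \<in> cball a r \<inter> cball b s"
    using assms(2,3) by (auto simp: cball_eq_atLeastAtMost)
  then show False using assms(1) unfolding disjnt_def by blast
qed

text \<open>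
  Half of Lebesgue's differentiation argument: the intervals on which \<open>F\<close> has slope at most \<open>c\<close>
  form a Vitali cover of \<open>E\<close>, and the images of disjoint intervals under a strictly increasing function are
  disjoint.  Applied to \<open>F\<close> and to its inverse, the lemma bounds \<open>F ` E\<close> by \<open>E\<close> and \<open>E\<close> by \<open>F ` E\<close>.
  The set \<open>W\<close> stands in for the outer measure, so that measurability of \<open>F ` E\<close> is not an issue.
\<close>

lemma strict_mono_image_measure_bound:
  fixes F :: "real \<Rightarrow> real"
  assumes F: "strict_mono F"
    and null: "\<And>N. negligible N \<Longrightarrow> negligible (F ` N)"
    and U: "open U" "E \<subseteq> U" and c: "0 \<le> c"
    and cover: "\<And>x d. x \<in> E \<Longrightarrow> 0 < d \<Longrightarrow>
       \<exists>a b. a < b \<and> b - a < d \<and> x \<in> {a..b} \<and> F b - F a \<le> c * (b - a)"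
  shows "\<exists>W \<in> sets lebesgue. F ` E \<subseteq> W \<and> emeasure lebesgue W \<le> ennreal c * emeasure lebesgue U"
proof -
  define K where "K = {(a, r). 0 < r \<and> cball a r \<subseteq> U \<and> F (a + r) - F (a - r) \<le> c * (2 * r)}"
  have "\<exists>i\<in>K. x \<in> cball (fst i) (snd i) \<and> snd i < d" if x: "x \<in> E" and d: "0 < d" for x d
  proof -
    obtain e where e: "0 < e" "ball x e \<subseteq> U" using U x by (meson open_contains_ball subsetD)
    obtain a b where ab: "a < b" "b - a < min d e" "x \<in> {a..b}" "F b - F a \<le> c * (b - a)"
      using cover[OF x, of "min d e"] d e by auto
    let ?i = "((a + b) / 2, (b - a) / 2)"
    have eq: "(a + b) / 2 + (b - a) / 2 = b" "(a + b) / 2 - (b - a) / 2 = a" by (simp_all add: field_simps)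
    have cb: "cball ((a + b) / 2) ((b - a) / 2) = {a..b}"
      unfolding cball_eq_atLeastAtMost eq ..
    have "{a..b} \<subseteq> ball x e" using ab by (auto simp: dist_real_def)
    then have "{a..b} \<subseteq> U" using e by blast
    moreover have "2 * ((b - a) / 2) = b - a" by simp
    ultimately have "?i \<in> K" using ab unfolding K_def mem_Collect_eq case_prod_conv cb eq
      by (metis half_gt_zero diff_gt_0_iff_gt)
    then show ?thesis using ab cb by (intro bexI[of _ ?i]) auto
  qed
  then have "\<exists>i. i \<in> K \<and> x \<in> cball (fst i) (snd i) \<and> snd i < d" if "x \<in> E" "0 < d" for x d
    using that by blast
  moreover have "0 < snd i" if "i \<in> K" for i using that by (auto simp: K_def)
  ultimately obtain C where C: "countable C" "C \<subseteq> K"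
     and disj: "pairwise (\<lambda>i j. disjnt (cball (fst i) (snd i)) (cball (fst j) (snd j))) C"
     and neg: "negligible (E - (\<Union>i\<in>C. cball (fst i) (snd i)))"
    using Vitali_covering_theorem_cballs[of K snd E fst] by blast
  define I where "I i = {F (fst i - snd i)..F (fst i + snd i)}" for i :: "real \<times> real"
  have pos: "0 < snd i" if "i \<in> C" for i using C that by (auto simp: K_def)
  have disj2: "disjoint_family_on I C"
  proof (unfold disjoint_family_on_def, intro ballI impI)
    fix i j assume ij: "i \<in> C" "j \<in> C" "i \<noteq> j"
    then have "fst i + snd i < fst j - snd j \<or> fst j + snd j < fst i - snd i"
      using disj pos[OF ij(1)] pos[OF ij(2)] by (intro disjoint_cballs_real) (auto simp: pairwise_def)
    then show "I i \<inter> I j = {}"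
      using F unfolding I_def strict_mono_def by fastforce
  qed
  have disj3: "disjoint_family_on (\<lambda>i. cball (fst i) (snd i)) C"
    using disj by (auto simp: disjoint_family_on_def pairwise_def disjnt_def)
  define N where "N = F ` (E - (\<Union>i\<in>C. cball (fst i) (snd i)))"
  have N: "negligible N" unfolding N_def by (rule null[OF neg])
  have "emeasure lebesgue (\<Union>i\<in>C. I i) = (\<integral>\<^sup>+ i. emeasure lebesgue (I i) \<partial>count_space C)"
    by (rule emeasure_UN_countable[OF _ C(1) disj2]) (auto simp: I_def)
  also have "\<dots> \<le> (\<integral>\<^sup>+ i. ennreal c * emeasure lebesgue (cball (fst i) (snd i)) \<partial>count_space C)"
  proof (rule nn_integral_mono)
    fix i assume "i \<in> space (count_space C)"
    then have i: "i \<in> C" by simp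
    then have "F (fst i + snd i) - F (fst i - snd i) \<le> c * (2 * snd i)" using C by (auto simp: K_def)
    moreover have "F (fst i - snd i) \<le> F (fst i + snd i)"
      using F pos[OF i] by (simp add: strict_mono_less_eq)
    ultimately show "emeasure lebesgue (I i) \<le> ennreal c * emeasure lebesgue (cball (fst i) (snd i))"
      using pos[OF i] c by (simp add: I_def cball_eq_atLeastAtMost flip: ennreal_mult)
  qed
  also have "\<dots> = ennreal c * (\<integral>\<^sup>+ i. emeasure lebesgue (cball (fst i) (snd i)) \<partial>count_space C)"
    by (rule nn_integral_cmult) simp
  also have "(\<integral>\<^sup>+ i. emeasure lebesgue (cball (fst i) (snd i)) \<partial>count_space C) = emeasure lebesgue (\<Union>i\<in>C. cball (fst i) (snd i))"
    by (rule emeasure_UN_countable[symmetric]) (auto simp: C disj3)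
  also have "\<dots> \<le> emeasure lebesgue U"
  proof (rule emeasure_mono)
    show "(\<Union>i\<in>C. cball (fst i) (snd i)) \<subseteq> U" using C(2) unfolding K_def by fastforce
  qed (use U in auto)
  finally have le: "emeasure lebesgue (\<Union>i\<in>C. I i) \<le> ennreal c * emeasure lebesgue U"
    by (simp add: mult_left_mono)
  have IS: "(\<Union>i\<in>C. I i) \<in> sets lebesgue" using C by (intro sets.countable_UN') (auto simp: I_def)
  have "F ` E \<subseteq> (\<Union>i\<in>C. I i) \<union> N"
    using F unfolding N_def I_def by (fastforce simp: cball_eq_atLeastAtMost strict_mono_less_eq)
  moreover have "emeasure lebesgue ((\<Union>i\<in>C. I i) \<union> N) = emeasure lebesgue (\<Union>i\<in>C. I i)"
    using N IS by (intro emeasure_Un_null_set) (auto simp: negligible_iff_null_sets)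
  ultimately show ?thesis
    using le IS N by (intro bexI[of _ "(\<Union>i\<in>C. I i) \<union> N"]) (auto simp: negligible_imp_sets)
qed

text \<open>
  The points where the difference quotients along \<open>v\<close> come below \<open>p\<close> and above \<open>q\<close> arbitrarily close
  to \<open>0\<close>.  With strict inequalities the set is a \<open>G\<^sub>\<delta>\<close> for continuous \<open>g\<close>, and for
  Lipschitz \<open>g\<close> the sets with rational \<open>p < q\<close> exhaust the failure of differentiability along \<open>v\<close>.
\<close>

definition oscillation_set :: "real \<Rightarrow> real \<Rightarrow> ('a::real_normed_vector \<Rightarrow> real) \<Rightarrow> 'a \<Rightarrow> 'a set" where
  "oscillation_set p q g v = {x. \<forall>n::nat.
     (\<exists>t. 0 < \<bar>t\<bar> \<and> \<bar>t\<bar> < 1 / (real n + 1) \<and> (g (x + t *\<^sub>R v) - g x) / t < p) \<and>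
     (\<exists>t. 0 < \<bar>t\<bar> \<and> \<bar>t\<bar> < 1 / (real n + 1) \<and> (g (x + t *\<^sub>R v) - g x) / t > q)}"

lemma borel_oscillation_set:
  fixes g :: "'a::real_normed_vector \<Rightarrow> real"
  assumes g: "continuous_on UNIV g"
  shows "oscillation_set p q g v \<in> sets borel"
proof -
  have c: "continuous_on UNIV (\<lambda>x. (g (x + t *\<^sub>R v) - g x) / t)" for t
    by (cases "t = 0") (auto intro!: continuous_intros continuous_on_compose2[OF g])
  define A where "A n = (\<Union>t\<in>{t. 0 < \<bar>t\<bar> \<and> \<bar>t\<bar> < 1 / (real n + 1)}. {x. (g (x + t *\<^sub>R v) - g x) / t < p})" for n :: nat
  define B where "B n = (\<Union>t\<in>{t. 0 < \<bar>t\<bar> \<and> \<bar>t\<bar> < 1 / (real n + 1)}. {x. (g (x + t *\<^sub>R v) - g x) / t > q})" for n :: nat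
  have "open (A n)" "open (B n)" for n
    unfolding A_def B_def by (intro open_UN ballI open_Collect_less c continuous_intros)+
  then have "(\<Inter>n. A n \<inter> B n) \<in> sets borel" by auto
  also have "(\<Inter>n. A n \<inter> B n) = oscillation_set p q g v"
    unfolding oscillation_set_def A_def B_def by auto
  finally show ?thesis .
qed

lemma negligible_lipschitz_image:
  fixes F :: "real \<Rightarrow> real"
  assumes F: "K-lipschitz_on UNIV F" and N: "negligible N"
  shows "negligible (F ` N)"
proof (rule negligible_locally_Lipschitz_image[OF _ N])
  fix x assume "x \<in> N"
  show "\<exists>T B. open T \<and> x \<in> T \<and> (\<forall>y\<in>N \<inter> T. norm (F y - F x) \<le> B * norm (y - x))"
    using lipschitz_onD[OF F] by (intro exI[of _ UNIV] exI[of _ K]) (auto simp: dist_norm)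
qed simp

text \<open>
  Adding a linear function turns a Lipschitz function into a strictly increasing \<open>F\<close> with Lipschitz
  inverse.  On the oscillation set \<open>E\<close> the slopes \<open>P < Q\<close> of \<open>F\<close> both occur at all small scales,
  so \<open>Q * \<lambda>(E) \<le> \<lambda>(F ` E) \<le> P * \<lambda>(E)\<close>, which forces \<open>\<lambda>(E) = 0\<close>.
\<close>

lemma negligible_oscillation_set_lipschitz:
  fixes \<phi> :: "real \<Rightarrow> real"
  assumes \<phi>: "L-lipschitz_on UNIV \<phi>" and pq: "p < q"
  shows "negligible (oscillation_set p q \<phi> 1)"
proof (subst negligible_on_intervals, intro allI)
  fix a b :: real
  define E where "E = oscillation_set p q \<phi> 1 \<inter> cbox a b"
  have L: "0 \<le> L" using \<phi> by (rule lipschitz_on_nonneg)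
  have lip: "\<bar>\<phi> x - \<phi> y\<bar> \<le> L * \<bar>x - y\<bar>" for x y
    using lipschitz_onD[OF \<phi>, of x y] by (simp add: dist_real_def)
  define F where "F t = \<phi> t + (L + 1) * t" for t
  have expand: "y - x \<le> F y - F x" if "x \<le> y" for x y
    using lip[of y x] that by (simp add: F_def algebra_simps abs_if split: if_splits)
  have upper: "F y - F x \<le> (2 * L + 1) * (y - x)" if "x \<le> y" for x y
    using lip[of y x] that by (simp add: F_def algebra_simps abs_if split: if_splits)
  have sm: "strict_mono F"
    unfolding strict_mono_def using expand by (smt (verit))
  have lipF: "(2 * L + 1)-lipschitz_on UNIV F"
  proof (rule lipschitz_onI)
    fix x y show "dist (F x) (F y) \<le> (2 * L + 1) * dist x y"
      using expand[of x y] expand[of y x] upper[of x y] upper[of y x]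
      by (cases "x \<le> y") (auto simp: dist_real_def abs_if)
  qed (use L in simp)
  have contF: "continuous_on S F" for S
    using lipschitz_on_continuous_on[OF lipF] continuous_on_subset by blast
  have "\<exists>x. F x = y" for y
  proof -
    have "F (- \<bar>y - F 0\<bar>) \<le> y" "y \<le> F \<bar>y - F 0\<bar>"
      using expand[of "- \<bar>y - F 0\<bar>" 0] expand[of 0 "\<bar>y - F 0\<bar>"] by auto
    then show ?thesis using IVT'[of F "- \<bar>y - F 0\<bar>" y "\<bar>y - F 0\<bar>"] contF by auto
  qed
  then have FG: "F (inv F y) = y" for y by (metis f_inv_into_f rangeI)
  have GF: "inv F (F x) = x" for x using sm by (simp add: strict_mono_imp_increasing strict_mono_eq inv_f_f inj_def)
  have smG: "strict_mono (inv F)"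
    unfolding strict_mono_def by (metis FG sm strict_mono_less)
  have lipG: "1-lipschitz_on UNIV (inv F)"
  proof (rule lipschitz_onI)
    fix x y show "dist (inv F x) (inv F y) \<le> 1 * dist x y"
      using expand[of "inv F x" "inv F y"] expand[of "inv F y" "inv F x"]
      by (cases "inv F x \<le> inv F y") (auto simp: dist_real_def FG abs_if)
  qed simp
  have quot: "(F (x + t) - F x) / t = (\<phi> (x + t) - \<phi> x) / t + (L + 1)" if "t \<noteq> 0" for x t
    using that by (simp add: F_def field_simps)
  have lower_steep: "\<exists>a b. a < b \<and> b - a < d \<and> x \<in> {a..b} \<and> F b - F a \<le> (p + L + 1) * (b - a)"
   and upper_steep: "\<exists>a b. a < b \<and> b - a < d \<and> x \<in> {a..b} \<and> F b - F a \<ge> (q + L + 1) * (b - a)"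
    if x: "x \<in> E" and d: "0 < d" for x d
  proof -
    obtain n :: nat where n: "1 / (real n + 1) < d" using d
      by (blast dest: ex_inverse_nat_less)
    from x obtain t s where t: "0 < \<bar>t\<bar>" "\<bar>t\<bar> < 1 / (real n + 1)" "(\<phi> (x + t) - \<phi> x) / t < p"
      and s: "0 < \<bar>s\<bar>" "\<bar>s\<bar> < 1 / (real n + 1)" "(\<phi> (x + s) - \<phi> x) / s > q"
      unfolding E_def oscillation_set_def by (simp del: zero_less_abs_iff) metis
    have t': "(F (x + t) - F x) / t \<le> p + L + 1" and td: "\<bar>t\<bar> < d"
      using quot[of t x] t n by auto
    show "\<exists>a b. a < b \<and> b - a < d \<and> x \<in> {a..b} \<and> F b - F a \<le> (p + L + 1) * (b - a)"
    proof (cases "0 < t")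
      case True then show ?thesis using t' td
        by (intro exI[of _ x] exI[of _ "x + t"]) (simp add: divide_le_eq)
    next
      case False then have "t < 0" using t by simp
      then show ?thesis using t' td
        by (intro exI[of _ "x + t"] exI[of _ x]) (simp add: divide_le_eq)
    qed
    have s': "(F (x + s) - F x) / s \<ge> q + L + 1" and sd: "\<bar>s\<bar> < d"
      using quot[of s x] s n by auto
    show "\<exists>a b. a < b \<and> b - a < d \<and> x \<in> {a..b} \<and> F b - F a \<ge> (q + L + 1) * (b - a)"
    proof (cases "0 < s")
      case True then show ?thesis using s' sd
        by (intro exI[of _ x] exI[of _ "x + s"]) (simp add: le_divide_eq)
    next
      case False then have "s < 0" using s by simp
      then show ?thesis using s' sd
        by (intro exI[of _ "x + s"] exI[of _ x]) (simp add: le_divide_eq)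
    qed
  qed
  show "negligible (oscillation_set p q \<phi> 1 \<inter> cbox a b)"
  proof (cases "E = {}")
    case True then show ?thesis by (simp add: E_def)
  next
    case False
    \<comment> \<open>The slopes of \<open>F\<close> that correspond to the slopes \<open>p\<close> and \<open>q\<close> of \<open>\<phi>\<close>.\<close>
    define P where "P = p + L + 1"
    define Q where "Q = q + L + 1"
    have "0 < P"
    proof -
      obtain x where "x \<in> E" using False by auto
      then obtain a b where "a < b" "F b - F a \<le> P * (b - a)" using lower_steep[of x 1] by (auto simp: P_def)
      then have "0 < P * (b - a)" using expand[of a b] by linarith
      then show ?thesis using \<open>a < b\<close> by (simp add: zero_less_mult_iff)
    qed
    have "P < Q" using pq by (simp add: P_def Q_def)
    have "E \<in> sets borel" unfolding E_def
      using borel_oscillation_set[of \<phi> p q 1] lipschitz_on_continuous_on[OF \<phi>] by auto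
    then have Es: "E \<in> sets lebesgue" by auto
    have "emeasure lebesgue E \<le> emeasure lebesgue (cbox a b)"
      unfolding E_def by (rule emeasure_mono) auto
    also have "\<dots> < \<infinity>" using emeasure_lborel_cbox_finite[of a b] by simp
    finally have fin: "emeasure lebesgue E < \<infinity>" .
    then have lm: "E \<in> lmeasurable" using Es by (intro fmeasurableI)
    define s where "s = measure lebesgue E"
    have s: "emeasure lebesgue E = ennreal s" unfolding s_def
      using lm by (simp add: emeasure_eq_measure2)
    have s0: "0 \<le> s" by (simp add: s_def)
    have "Q * s \<le> P * s"
    proof (rule field_le_epsilon)
      fix e :: real assume e: "0 < e"
      define \<epsilon> where "\<epsilon> = e / (P + 1)"
      have \<epsilon>: "0 < \<epsilon>" using e \<open>0 < P\<close> by (simp add: \<epsilon>_def)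
      obtain U where U: "open U" "E \<subseteq> U" "emeasure lebesgue (U - E) < \<epsilon>"
        using sets_lebesgue_outer_open[OF Es \<epsilon>] by metis
      have "emeasure lebesgue U = emeasure lebesgue E + emeasure lebesgue (U - E)"
        using U Es by (subst plus_emeasure) (auto simp: Un_absorb1)
      also have "\<dots> \<le> ennreal s + ennreal \<epsilon>" using U s by (intro add_mono) auto
      finally have mU: "emeasure lebesgue U \<le> ennreal (s + \<epsilon>)" using s0 \<epsilon> by simp
      obtain W where W: "W \<in> sets lebesgue" "F ` E \<subseteq> W" "emeasure lebesgue W \<le> ennreal P * emeasure lebesgue U"
        using strict_mono_image_measure_bound[OF sm negligible_lipschitz_image[OF lipF] U(1,2), of P]
          lower_steep \<open>0 < P\<close> unfolding P_def[symmetric] by force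
      have "emeasure lebesgue W \<le> ennreal P * ennreal (s + \<epsilon>)"
        by (rule order_trans[OF W(3)]) (intro mult_left_mono mU, simp)
      then have mW: "emeasure lebesgue W \<le> ennreal (P * (s + \<epsilon>))"
        using \<open>0 < P\<close> by (simp add: ennreal_mult')
      \<comment> \<open>The same bound for the inverse of \<open>F\<close>, where slope at least \<open>Q\<close> becomes slope at most \<open>1 / Q\<close>.\<close>
      obtain U' where U': "open U'" "W \<subseteq> U'" "emeasure lebesgue (U' - W) < \<epsilon>"
        using sets_lebesgue_outer_open[OF W(1) \<epsilon>] by metis
      have "emeasure lebesgue U' = emeasure lebesgue W + emeasure lebesgue (U' - W)"
        using U' W by (subst plus_emeasure) (auto simp: Un_absorb1)
      also have "\<dots> \<le> ennreal (P * (s + \<epsilon>)) + ennreal \<epsilon>" using U' mW by (intro add_mono) auto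
      finally have mU': "emeasure lebesgue U' \<le> ennreal (P * (s + \<epsilon>) + \<epsilon>)"
        using s0 \<epsilon> \<open>0 < P\<close> by simp
      have cov: "\<exists>a b. a < b \<and> b - a < d \<and> y \<in> {a..b} \<and> inv F b - inv F a \<le> 1 / Q * (b - a)"
        if y: "y \<in> F ` E" and d: "0 < d" for y d
      proof -
        obtain x where x: "x \<in> E" "y = F x" using y by auto
        have "0 < d / (2 * L + 1)" using d L by simp
        then obtain a b where ab: "a < b" "b - a < d / (2 * L + 1)" "x \<in> {a..b}" "F b - F a \<ge> Q * (b - a)"
          using upper_steep[OF x(1), of "d / (2 * L + 1)"] unfolding Q_def by auto
        have "F b - F a < d" using upper[of a b] ab L by (simp add: field_simps)
        moreover have "F a < F b" "F a \<le> F x" "F x \<le> F b"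
          using sm ab by (auto simp: strict_mono_less strict_mono_less_eq)
        ultimately show ?thesis using ab \<open>0 < P\<close> \<open>P < Q\<close> x
          by (intro exI[of _ "F a"] exI[of _ "F b"]) (auto simp: GF field_simps)
      qed
      obtain W' where W': "W' \<in> sets lebesgue" "inv F ` F ` E \<subseteq> W'" "emeasure lebesgue W' \<le> ennreal (1 / Q) * emeasure lebesgue U'"
      proof -
        have "F ` E \<subseteq> U'" using U'(2) W(2) by blast
        moreover have "0 \<le> 1 / Q" using \<open>0 < P\<close> \<open>P < Q\<close> by simp
        ultimately show ?thesis
          using strict_mono_image_measure_bound[OF smG negligible_lipschitz_image[OF lipG] U'(1) _ _ cov] that
          by blast
      qed
      have "ennreal s \<le> emeasure lebesgue W'"
        unfolding s[symmetric] using W' by (intro emeasure_mono) (auto simp: image_image GF)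
      also have "\<dots> \<le> ennreal (1 / Q) * ennreal (P * (s + \<epsilon>) + \<epsilon>)"
        by (rule order_trans[OF W'(3)]) (intro mult_left_mono mU', simp)
      also have "\<dots> = ennreal (1 / Q * (P * (s + \<epsilon>) + \<epsilon>))"
        using \<open>0 < P\<close> \<open>P < Q\<close> s0 \<epsilon> by (intro ennreal_mult[symmetric]) auto
      finally have "s \<le> 1 / Q * (P * (s + \<epsilon>) + \<epsilon>)"
        using s0 \<epsilon> \<open>0 < P\<close> \<open>P < Q\<close> by (subst (asm) ennreal_le_iff) auto
      then have "Q * s \<le> P * s + (P + 1) * \<epsilon>"
        using \<open>0 < P\<close> \<open>P < Q\<close> by (simp add: field_simps)
      then show "Q * s \<le> P * s + e" using \<open>0 < P\<close> by (simp add: \<epsilon>_def)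
    qed
    then have "s = 0" using s0 \<open>P < Q\<close> by (metis mult_le_cancel_right not_le order_antisym_conv)
    then show ?thesis using lm by (simp add: negligible_iff_measure s_def E_def)
  qed
qed

text \<open>
  For each \<open>n\<close>, disjoint intervals of a Vitali cover on which \<open>g\<close> has slope at least \<open>n / 2\<close> have total
  length at most \<open>2 * (g b - g a) / n\<close>, because the increments of \<open>g\<close> over them are lengths of disjoint
  intervals between \<open>g a\<close> and \<open>g b\<close>.
\<close>

lemma negligible_infinite_derivate_mono:
  fixes g :: "real \<Rightarrow> real"
  assumes g: "mono_on {a..b} g"
  shows "negligible {t. \<forall>n::nat. \<exists>s. 0 < s \<and> s < 1 / (real n + 1) \<and> a \<le> t - s \<and> t + s \<le> b \<and>
      real n * s < g (t + s) - g (t - s)}" (is "negligible ?B")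
  unfolding negligible_outer_le
proof (intro allI impI)
  fix e :: real assume e: "0 < e"
  obtain n0 :: nat where n0: "2 * (g b - g a) / e < real n0" using reals_Archimedean2 by blast
  define n where "n = Suc n0"
  have n: "0 < real n" "2 * (g b - g a) / real n \<le> e"
  proof -
    have "2 * (g b - g a) / e < real n" using n0 by (simp add: n_def)
    then show "2 * (g b - g a) / real n \<le> e" using e by (simp add: field_simps n_def)
  qed (simp add: n_def)
  define K where "K = {(t, s). 0 < s \<and> a \<le> t - s \<and> t + s \<le> b \<and> real n * s \<le> g (t + s) - g (t - s)}"
  have "\<exists>i. i \<in> K \<and> x \<in> cball (fst i) (snd i) \<and> snd i < d" if x: "x \<in> ?B" and d: "0 < d" for x d
  proof -
    obtain k0 :: nat where k0: "1 / (real k0 + 1) < d" using d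
      by (blast dest: ex_inverse_nat_less)
    define k where "k = max k0 n"
    have "1 / (real k + 1) \<le> 1 / (real k0 + 1)" by (simp add: k_def frac_le)
    moreover obtain s where s: "0 < s" "s < 1 / (real k + 1)" "a \<le> x - s" "x + s \<le> b" "real k * s < g (x + s) - g (x - s)"
      using x by blast
    ultimately have "s < d" using k0 by linarith
    have "real n * s \<le> real k * s" using s(1) by (intro mult_right_mono) (auto simp: k_def)
    then have "real n * s \<le> g (x + s) - g (x - s)" using s(5) by linarith
    then have "(x, s) \<in> K" using s unfolding K_def by auto
    then show ?thesis using s \<open>s < d\<close> by (intro exI[of _ "(x, s)"]) auto
  qed
  moreover have "0 < snd i" if "i \<in> K" for i using that by (auto simp: K_def)
  ultimately obtain C where C: "countable C" "C \<subseteq> K"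
     and disj: "pairwise (\<lambda>i j. disjnt (cball (fst i) (snd i)) (cball (fst j) (snd j))) C"
     and neg: "negligible (?B - (\<Union>i\<in>C. cball (fst i) (snd i)))"
    using Vitali_covering_theorem_cballs[of K snd ?B fst] by blast
  define I where "I i = {g (fst i - snd i)<..g (fst i + snd i)}" for i :: "real \<times> real"
  have inK: "0 < snd i" "a \<le> fst i - snd i" "fst i + snd i \<le> b"
    "real n * snd i \<le> g (fst i + snd i) - g (fst i - snd i)" if "i \<in> C" for i
    using C that by (auto simp: K_def)
  have disj3: "disjoint_family_on (\<lambda>i. cball (fst i) (snd i)) C"
    using disj by (auto simp: disjoint_family_on_def pairwise_def disjnt_def)
  have disj2: "disjoint_family_on I C"
  proof (unfold disjoint_family_on_def, intro ballI impI)
    fix i j assume ij: "i \<in> C" "j \<in> C" "i \<noteq> j"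
    then have "fst i + snd i < fst j - snd j \<or> fst j + snd j < fst i - snd i"
      using disj inK(1)[OF ij(1)] inK(1)[OF ij(2)] by (intro disjoint_cballs_real) (auto simp: pairwise_def)
    then have "g (fst i + snd i) \<le> g (fst j - snd j) \<or> g (fst j + snd j) \<le> g (fst i - snd i)"
      using inK[OF ij(1)] inK[OF ij(2)] by (auto intro!: mono_onD[OF g])
    then show "I i \<inter> I j = {}" unfolding I_def by auto
  qed
  let ?V = "\<Union>i\<in>C. cball (fst i) (snd i)"
  have "ennreal (real n) * emeasure lebesgue ?V = ennreal (real n) * (\<integral>\<^sup>+ i. emeasure lebesgue (cball (fst i) (snd i)) \<partial>count_space C)"
    by (subst emeasure_UN_countable[OF _ C(1) disj3]) auto
  also have "\<dots> = (\<integral>\<^sup>+ i. ennreal (real n) * emeasure lebesgue (cball (fst i) (snd i)) \<partial>count_space C)"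
    by (rule nn_integral_cmult[symmetric]) simp
  also have "\<dots> \<le> (\<integral>\<^sup>+ i. 2 * emeasure lebesgue (I i) \<partial>count_space C)"
  proof (rule nn_integral_mono)
    fix i assume "i \<in> space (count_space C)"
    then have i: "i \<in> C" by simp
    have nonneg: "0 \<le> real n * snd i" using inK[OF i] by simp
    have "ennreal (real n) * emeasure lebesgue (cball (fst i) (snd i)) = ennreal (real n * (2 * snd i))"
      using inK(1)[OF i] by (simp add: cball_eq_atLeastAtMost ennreal_mult')
    also have "\<dots> \<le> ennreal (2 * (g (fst i + snd i) - g (fst i - snd i)))"
      using inK(4)[OF i] by (intro ennreal_leI) auto
    also have "\<dots> = 2 * ennreal (g (fst i + snd i) - g (fst i - snd i))"
      using inK(4)[OF i] nonneg by (subst ennreal_mult) auto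
    also have "\<dots> = 2 * emeasure lebesgue (I i)"
      using inK(4)[OF i] nonneg by (simp add: I_def)
    finally show "ennreal (real n) * emeasure lebesgue (cball (fst i) (snd i)) \<le> 2 * emeasure lebesgue (I i)" .
  qed
  also have "\<dots> = 2 * (\<integral>\<^sup>+ i. emeasure lebesgue (I i) \<partial>count_space C)"
    by (rule nn_integral_cmult) simp
  also have "(\<integral>\<^sup>+ i. emeasure lebesgue (I i) \<partial>count_space C) = emeasure lebesgue (\<Union>i\<in>C. I i)"
    by (rule emeasure_UN_countable[OF _ C(1) disj2, symmetric]) (auto simp: I_def)
  also have "\<dots> \<le> emeasure lebesgue {g a..g b}"
  proof (rule emeasure_mono)
    show "(\<Union>i\<in>C. I i) \<subseteq> {g a..g b}"
    proof (rule UN_least)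
      fix i assume i: "i \<in> C"
      have "g a \<le> g (fst i - snd i)" "g (fst i + snd i) \<le> g b"
        using inK[OF i] by (auto intro!: mono_onD[OF g])
      then show "I i \<subseteq> {g a..g b}" by (auto simp: I_def)
    qed
  qed simp
  also have "\<dots> \<le> ennreal (max 0 (g b - g a))"
    by (cases "g a \<le> g b") auto
  finally have "ennreal (real n) * emeasure lebesgue ?V \<le> 2 * ennreal (max 0 (g b - g a))"
    by (simp add: mult_left_mono)
  also have "\<dots> = ennreal (2 * max 0 (g b - g a))" by (subst ennreal_mult) auto
  finally have le: "ennreal (real n) * emeasure lebesgue ?V \<le> ennreal (2 * max 0 (g b - g a))" .
  have Vs: "?V \<in> sets lebesgue" using C by (intro sets.countable_UN') auto
  have "emeasure lebesgue ?V < \<infinity>"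
  proof (rule ccontr)
    assume "\<not> ?thesis"
    then have "emeasure lebesgue ?V = \<infinity>" by (simp add: less_top[symmetric])
    then show False using le n by (simp add: ennreal_mult_top ennreal_mult_less_top top_unique)
  qed
  then have Vm: "?V \<in> lmeasurable" using Vs by (intro fmeasurableI)
  then have em: "emeasure lebesgue ?V = ennreal (measure lebesgue ?V)" by (rule emeasure_eq_measure2)
  have "ennreal (real n * measure lebesgue ?V) \<le> ennreal (2 * max 0 (g b - g a))"
    using le unfolding em by (subst ennreal_mult) auto
  then have nm: "real n * measure lebesgue ?V \<le> 2 * max 0 (g b - g a)" by (subst (asm) ennreal_le_iff) auto
  have "measure lebesgue ?V \<le> e"
  proof (cases "C = {}")
    case False
    then obtain i where "i \<in> C" by auto
    then have "g a \<le> g b" using inK[of i] by (intro mono_onD[OF g]) auto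
    then have "measure lebesgue ?V \<le> 2 * (g b - g a) / real n" using nm n by (simp add: field_simps)
    then show ?thesis using n by simp
  qed (use e in simp)
  moreover have "measure lebesgue (?V \<union> (?B - ?V)) = measure lebesgue ?V"
    using neg Vs by (intro measure_Un_null_set) (auto simp: negligible_iff_null_sets)
  moreover have "?V \<union> (?B - ?V) \<in> lmeasurable"
    using Vm negligible_imp_measurable[OF neg] by (rule fmeasurable.Un)
  ultimately show "\<exists>T. ?B \<subseteq> T \<and> T \<in> lmeasurable \<and> measure lebesgue T \<le> e"
    by (intro exI[of _ "?V \<union> (?B - ?V)"]) auto
qed

section \<open>Sets that are null along lines, and Haar null sets\<close>

definition line_null :: "'a::real_normed_vector set \<Rightarrow> 'a \<Rightarrow> bool" where
  "line_null A v \<longleftrightarrow> (\<forall>x. negligible {t::real. x + t *\<^sub>R v \<in> A})"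

text \<open>
  A set covered by Borel sets, one for each direction \<open>d i\<close>, each null on all lines in its own direction.
  This is the covering that defines Aronszajn null sets, required here for the single sequence \<open>d\<close>
  only.  Unlike for Haar null sets, closure under countable unions is immediate.
\<close>

definition dir_null :: "(nat \<Rightarrow> 'a::real_normed_vector) \<Rightarrow> 'a set \<Rightarrow> bool" where
  "dir_null d N \<longleftrightarrow> (\<exists>A. (\<forall>i. A i \<in> sets borel \<and> line_null (A i) (d i)) \<and> N \<subseteq> (\<Union>i. A i))"

lemma dir_null_subset: "dir_null d N \<Longrightarrow> N' \<subseteq> N \<Longrightarrow> dir_null d N'"
  unfolding dir_null_def by blast

lemma dir_null_single:
  assumes "A \<in> sets borel" "line_null A (d i)"
  shows "dir_null d A"
  unfolding dir_null_def using assms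
  by (intro exI[of _ "\<lambda>j. if j = i then A else {}"]) (auto simp: line_null_def)

lemma dir_null_UN_nat:
  assumes "\<And>k::nat. dir_null d (N k)"
  shows "dir_null d (\<Union>k. N k)"
proof -
  obtain A where A: "\<And>k i. A k i \<in> sets borel" "\<And>k i. line_null (A k i) (d i)" "\<And>k. N k \<subseteq> (\<Union>i. A k i)"
    using assms unfolding dir_null_def by metis
  show ?thesis unfolding dir_null_def
  proof (intro exI[of _ "\<lambda>i. \<Union>k. A k i"] conjI allI)
    fix i show "(\<Union>k. A k i) \<in> sets borel" using A(1) by auto
    show "line_null (\<Union>k. A k i) (d i)" unfolding line_null_def
    proof
      fix x
      have "{t. x + t *\<^sub>R d i \<in> (\<Union>k. A k i)} = (\<Union>k. {t. x + t *\<^sub>R d i \<in> A k i})" by auto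
      then show "negligible {t. x + t *\<^sub>R d i \<in> (\<Union>k. A k i)}"
        using A(2) by (auto simp: line_null_def intro!: negligible_Union_nat)
    qed
  qed (use A(3) in blast)
qed

lemma dir_null_UN:
  assumes "countable J" "\<And>k. k \<in> J \<Longrightarrow> dir_null d (N k)"
  shows "dir_null d (\<Union>k\<in>J. N k)"
proof (cases "J = {}")
  case True
  then show ?thesis using dir_null_single[of "{}" d 0] by (simp add: line_null_def)
next
  case False
  then have "(\<Union>k\<in>J. N k) = (\<Union>n. N (from_nat_into J n))"
    using range_from_nat_into[OF False assms(1)] by (metis image_image)
  then show ?thesis using assms False by (simp add: dir_null_UN_nat from_nat_into)
qed

lemma dir_null_Un: "dir_null d M \<Longrightarrow> dir_null d N \<Longrightarrow> dir_null d (M \<union> N)"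
  using dir_null_UN[of "{True, False}" d "\<lambda>b. if b then M else N"]
  by (simp add: Un_commute)

text \<open>
  The measure is the law of \<open>\<Phi> \<omega> = (\<Sum>i. c i * \<omega> i * d i)\<close> under independent uniform coordinates.
  Resampling the coordinate \<open>i\<close> moves \<open>\<Phi> \<omega>\<close> along the direction \<open>d i\<close>, so by Fubini's theorem a Borel
  set that is null along \<open>d i\<close> is not charged, and neither are its translates.
\<close>

lemma dir_null_imp_haar_null:
  fixes d :: "nat \<Rightarrow> 'a::banach"
  assumes "dir_null d N"
  shows "\<exists>E. haar_null E \<and> N \<subseteq> E"
proof -
  obtain A where A: "\<And>i. A i \<in> sets borel" "\<And>i. line_null (A i) (d i)" and NA: "N \<subseteq> (\<Union>i. A i)"
    using assms unfolding dir_null_def by blast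
  define c where "c i = (1/2)^i / (1 + norm (d i))" for i
  have c: "0 < c i" "c i * norm (d i) \<le> (1/2)^i" for i
  proof -
    have "0 < 1 + norm (d i)" by (simp add: add_pos_nonneg)
    then show "0 < c i" by (simp add: c_def)
    have "norm (d i) / (1 + norm (d i)) \<le> 1" by (simp add: divide_le_eq add_pos_nonneg)
    then have "(1/2)^i * (norm (d i) / (1 + norm (d i))) \<le> (1/2)^i * 1"
      by (intro mult_left_mono) auto
    then show "c i * norm (d i) \<le> (1/2)^i" by (simp add: c_def)
  qed
  \<comment> \<open>Clamping the coordinates to the unit interval makes \<open>\<Phi>\<close> a uniform limit of continuous maps, hence Borel, without changing its law.\<close>
  define k :: "real \<Rightarrow> real" where "k s = max 0 (min 1 s)" for s
  have k01: "0 \<le> k s" "k s \<le> 1" for s by (auto simp: k_def)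
  have kc: "continuous_on UNIV k" unfolding k_def by (intro continuous_intros)
  define \<Phi> where "\<Phi> \<omega> = (\<Sum>i. (c i * k (\<omega> i)) *\<^sub>R d i)" for \<omega> :: "nat \<Rightarrow> real"
  have nle: "norm ((c i * k s) *\<^sub>R d i) \<le> (1/2)^i" for i s
  proof -
    have "norm ((c i * k s) *\<^sub>R d i) = k s * (c i * norm (d i))"
      using c(1)[of i] k01[of s] by (simp add: abs_mult)
    also have "\<dots> \<le> 1 * (1/2)^i"
      using c[of i] k01[of s] by (intro mult_mono) auto
    finally show ?thesis by simp
  qed
  have sumM: "summable (\<lambda>i. (1/2)^i :: real)" by (rule summable_geometric) simp
  have summ: "summable (\<lambda>i. (c i * k (\<omega> i)) *\<^sub>R d i)" for \<omega>
    by (rule summable_comparison_test'[OF sumM, of 0]) (rule nle)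
  have cont: "continuous_on UNIV \<Phi>"
    unfolding \<Phi>_def
  proof (rule uniform_limit_theorem)
    show "uniform_limit UNIV (\<lambda>n \<omega>. \<Sum>i<n. (c i * k (\<omega> i)) *\<^sub>R d i) (\<lambda>\<omega>. \<Sum>i. (c i * k (\<omega> i)) *\<^sub>R d i) sequentially"
      by (rule Weierstrass_m_test[OF _ sumM]) (rule nle)
    show "\<forall>\<^sub>F n in sequentially. continuous_on UNIV (\<lambda>\<omega>. \<Sum>i<n. (c i * k (\<omega> i)) *\<^sub>R d i)"
      by (intro always_eventually allI continuous_intros continuous_on_compose2[OF kc] continuous_on_product_coordinates) auto
  qed simp
  define U where "U = uniform_measure lborel {0..1::real}"
  have U: "prob_space U" unfolding U_def by (rule prob_space_uniform_measure) auto
  have sU: "sets U = sets borel" by (simp add: U_def)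
  have U_null: "emeasure U T = 0" if "T \<in> sets borel" "emeasure lborel ({0..1} \<inter> T) = 0" for T
    using that unfolding U_def by (subst emeasure_uniform_measure) auto
  define P where "P = PiM UNIV (\<lambda>_::nat. U)"
  have P: "prob_space P" unfolding P_def by (rule prob_space_PiM) (rule U)
  have sP: "sets P = sets borel"
    unfolding P_def sets_PiM_equal_borel[symmetric] by (rule sets_PiM_cong) (simp_all add: sU)
  have mP: "\<Phi> \<in> measurable P borel"
    using borel_measurable_continuous_onI[OF cont] by (simp add: measurable_cong_sets[OF sP refl])
  define M where "M = distr P borel \<Phi>"
  interpret PP: prob_space P by (rule P)
  interpret UU: prob_space U by (rule U)
  have M: "prob_space M" unfolding M_def by (rule PP.prob_space_distr[OF mP])
  have upd: "\<Phi> (fun_upd \<omega> i s) = \<Phi> (fun_upd \<omega> i 0) + (c i * k s) *\<^sub>R d i" for \<omega> i s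
  proof -
    have "\<Phi> (fun_upd \<omega> i s) - \<Phi> (fun_upd \<omega> i 0) =
       (\<Sum>j. (c j * k ((fun_upd \<omega> i s) j)) *\<^sub>R d j - (c j * k ((fun_upd \<omega> i 0) j)) *\<^sub>R d j)"
      unfolding \<Phi>_def by (rule suminf_diff[OF summ summ])
    also have "\<dots> = (\<Sum>j. if j = i then (c i * k s) *\<^sub>R d i else 0)"
      by (intro suminf_cong) (auto simp: k_def)
    also have "\<dots> = (c i * k s) *\<^sub>R d i" using sums_single[of i "\<lambda>_. (c i * k s) *\<^sub>R d i"]
      by (simp add: sums_iff)
    finally show ?thesis by (simp add: algebra_simps)
  qed
  have shift: "(\<lambda>e. x + e) ` B = (\<lambda>y. y - x) -` B" for x and B :: "'a set"
    by (force simp: image_iff)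
  have shiftb: "(\<lambda>e. x + e) ` B \<in> sets borel" if "B \<in> sets borel" for x and B :: "'a set"
  proof -
    have "(\<lambda>y. y - x) \<in> borel_measurable borel"
      by (intro borel_measurable_continuous_onI continuous_intros)
    from measurable_sets[OF this that] show ?thesis by (simp add: shift)
  qed
  have null: "emeasure M ((\<lambda>e. x + e) ` A i) = 0" for x i
  proof -
    define B where "B = (\<lambda>e. x + e) ` A i"
    have B: "B \<in> sets borel" unfolding B_def by (rule shiftb[OF A(1)])
    have V: "\<Phi> -` B \<in> sets P" using measurable_sets[OF mP B] sP
      by (metis Int_UNIV_right sets_eq_imp_space_eq space_borel)
    have iter: "distr (U \<Otimes>\<^sub>M P) P (\<lambda>(s, \<omega>). fun_upd \<omega> i s) = P"
      using distr_pair_PiM_eq_PiM[of UNIV "\<lambda>_. U" i] U by (simp add: P_def)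
    have meas: "(\<lambda>(s, \<omega>). fun_upd \<omega> i s) \<in> measurable (U \<Otimes>\<^sub>M P) P"
      using measurable_fun_upd[of UNIV UNIV i snd "U \<Otimes>\<^sub>M P" "\<lambda>_. U" fst] unfolding P_def case_prod_beta by auto
    let ?S = "(\<lambda>(s, \<omega>). fun_upd \<omega> i s) -` (\<Phi> -` B) \<inter> space (U \<Otimes>\<^sub>M P)"
    have S: "?S \<in> sets (U \<Otimes>\<^sub>M P)" by (rule measurable_sets[OF meas V])
    have zero: "emeasure U ((\<lambda>s. (s, \<omega>)) -` ?S) = 0" for \<omega>
    proof -
      have T: "(\<lambda>s. (s, \<omega>)) -` ?S \<in> sets borel"
        using sets_Pair2[OF S, of \<omega>] sU by simp
      define z where "z = \<Phi> (fun_upd \<omega> i 0) - x"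
      have "{0..1} \<inter> (\<lambda>s. (s, \<omega>)) -` ?S \<subseteq> (\<lambda>t. t / c i) ` {t. z + t *\<^sub>R d i \<in> A i}"
      proof
        fix s assume "s \<in> {0..1} \<inter> (\<lambda>s. (s, \<omega>)) -` ?S"
        then have s: "s \<in> {0..1}" "\<Phi> (fun_upd \<omega> i s) - x \<in> A i" by (auto simp: B_def)
        then have "z + (c i * s) *\<^sub>R d i \<in> A i" by (simp add: upd[of \<omega> i s] z_def k_def algebra_simps)
        then show "s \<in> (\<lambda>t. t / c i) ` {t. z + t *\<^sub>R d i \<in> A i}" using c(1)[of i]
          by (intro image_eqI[of _ _ "c i * s"]) auto
      qed
      moreover have "negligible ((\<lambda>t. t / c i) ` {t. z + t *\<^sub>R d i \<in> A i})"
      proof (rule negligible_lipschitz_image)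
        show "(1 / c i)-lipschitz_on UNIV (\<lambda>t. t / c i)"
          using c(1)[of i] by (intro lipschitz_onI) (auto simp: dist_real_def abs_divide simp flip: diff_divide_distrib)
        show "negligible {t. z + t *\<^sub>R d i \<in> A i}" using A(2)[of i] by (simp add: line_null_def)
      qed
      ultimately have "negligible ({0..1} \<inter> (\<lambda>s. (s, \<omega>)) -` ?S)" by (rule negligible_subset[rotated])
      moreover have Tb: "{0..1} \<inter> (\<lambda>s. (s, \<omega>)) -` ?S \<in> sets borel" using T by (intro sets.Int) auto
      ultimately have "emeasure lborel ({0..1} \<inter> (\<lambda>s. (s, \<omega>)) -` ?S) = 0"
        by (subst (asm) negligible_iff_emeasure0) auto
      with T show ?thesis by (rule U_null)
    qed
    interpret UP: pair_sigma_finite U P ..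
    have "emeasure M B = emeasure P (\<Phi> -` B)"
      unfolding M_def using V by (subst emeasure_distr[OF mP B]) (simp add: sets_eq_imp_space_eq[OF sP])
    also have "\<dots> = emeasure (distr (U \<Otimes>\<^sub>M P) P (\<lambda>(s, \<omega>). fun_upd \<omega> i s)) (\<Phi> -` B)" by (simp add: iter)
    also have "\<dots> = emeasure (U \<Otimes>\<^sub>M P) ?S" by (rule emeasure_distr[OF meas V])
    also have "\<dots> = 0" unfolding UP.emeasure_pair_measure_alt2[OF S] zero by simp
    finally show ?thesis by (simp add: B_def)
  qed
  have "emeasure M ((\<lambda>e. x + e) ` (\<Union>i. A i)) = 0" for x
  proof -
    have "(\<Union>i. (\<lambda>e. x + e) ` A i) \<in> null_sets M"
      using null shiftb[OF A(1)] by (intro null_sets_UN) (auto simp: null_sets_def M_def)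
    then show ?thesis by (simp add: image_UN null_sets_def)
  qed
  then have "haar_null (\<Union>i. A i)" unfolding haar_null_def using M A(1)
    by (intro conjI exI[of _ M]) (auto simp: M_def)
  then show ?thesis using NA by blast
qed

text \<open>
  Countably many translates of a ball cover a separable space, so a set containing a ball cannot have
  all translates null for a probability measure.
\<close>

lemma haar_null_complement_dense:
  fixes E :: "'a::real_normed_vector set"
  assumes sep: "separable_space (euclidean :: 'a topology)" and E: "haar_null E"
  shows "closure (- E) = UNIV"
proof (rule ccontr)
  assume "closure (- E) \<noteq> UNIV"
  then obtain z where "z \<notin> closure (- E)" by blast
  then have "z \<in> interior E" by (simp add: closure_complement)
  then obtain r where r: "0 < r" "ball z r \<subseteq> E" by (auto simp: mem_interior)
  obtain D :: "'a set" where D: "countable D" "closure D = UNIV"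
    using sep unfolding separable_space_def by (auto simp: closure_of_eq)
  obtain M :: "'a measure" where M: "prob_space M" "sets M = sets borel" "\<And>x. emeasure M ((\<lambda>e. x + e) ` E) = 0"
    using E unfolding haar_null_def by blast
  interpret prob_space M by (rule M(1))
  have "\<exists>y\<in>D. dist y x < r" for x using D(2) r(1) by (metis UNIV_I closure_approachable)
  moreover have "x \<in> (\<lambda>e. (y - z) + e) ` E" if "dist y x < r" for x y
  proof -
    have "z + x - y \<in> ball z r" using that by (simp add: dist_norm norm_minus_commute algebra_simps)
    then show ?thesis using r by (intro image_eqI[of _ _ "z + x - y"]) (auto simp: algebra_simps)
  qed
  ultimately have "x \<in> (\<Union>y\<in>D. (\<lambda>e. (y - z) + e) ` E)" for x by blast
  then have "(\<Union>y\<in>D. (\<lambda>e. (y - z) + e) ` E) = space M"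
    using sets_eq_imp_space_eq[OF M(2)] by auto
  moreover have "(\<lambda>e. (y - z) + e) ` E \<in> null_sets M" for y
  proof -
    have "(\<lambda>e. (y - z) + e) ` E = (\<lambda>x. x - (y - z)) -` E" by (force simp: image_iff)
    moreover have "(\<lambda>x. x - (y - z)) \<in> borel_measurable borel"
      by (intro borel_measurable_continuous_onI continuous_intros)
    ultimately have "(\<lambda>e. (y - z) + e) ` E \<in> sets borel"
      using E measurable_sets[of "\<lambda>x. x - (y - z)" borel borel E] by (simp add: haar_null_def)
    then show ?thesis using M by (simp add: null_sets_def)
  qed
  then have "(\<Union>y\<in>D. (\<lambda>e. (y - z) + e) ` E) \<in> null_sets M" using D(1) by (intro null_sets_UN') auto
  ultimately show False using emeasure_space_1 by (simp add: null_sets_def)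
qed

section \<open>Directional derivatives of Lipschitz functions\<close>

text \<open>
  On a line in direction \<open>v\<close> the set is the one-dimensional oscillation set of the restriction of \<open>g\<close>.
\<close>

lemma line_null_oscillation_set:
  fixes g :: "'a::real_normed_vector \<Rightarrow> real"
  assumes g: "L-lipschitz_on UNIV g" and "p < q"
  shows "line_null (oscillation_set p q g v) v"
  unfolding line_null_def
proof
  fix x
  have "(L * norm v)-lipschitz_on UNIV (\<lambda>t. g (x + t *\<^sub>R v))"
  proof (rule lipschitz_onI)
    fix s t :: real
    have "dist (g (x + s *\<^sub>R v)) (g (x + t *\<^sub>R v)) \<le> L * dist (x + s *\<^sub>R v) (x + t *\<^sub>R v)"
      by (rule lipschitz_onD[OF g]) auto
    also have "dist (x + s *\<^sub>R v) (x + t *\<^sub>R v) = dist s t * norm v"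
      by (simp add: dist_norm flip: scaleR_left_diff_distrib)
    finally show "dist (g (x + s *\<^sub>R v)) (g (x + t *\<^sub>R v)) \<le> L * norm v * dist s t" by (simp add: mult_ac)
  qed (use lipschitz_on_nonneg[OF g] in simp)
  from negligible_oscillation_set_lipschitz[OF this \<open>p < q\<close>]
  show "negligible {t. x + t *\<^sub>R v \<in> oscillation_set p q g v}"
    unfolding oscillation_set_def by (simp add: algebra_simps)
qed

definition nondifferentiable_along :: "('a::real_normed_vector \<Rightarrow> real) \<Rightarrow> 'a \<Rightarrow> 'a set" where
  "nondifferentiable_along g v = (\<Union>(p, q)\<in>{(p, q). p \<in> \<rat> \<and> q \<in> \<rat> \<and> p < q}. oscillation_set p q g v)"

lemma dir_null_nondifferentiable_along:
  fixes g :: "'a::real_normed_vector \<Rightarrow> real"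
  assumes g: "L-lipschitz_on UNIV g"
  shows "dir_null d (nondifferentiable_along g (d i))"
proof -
  have "countable {(p, q). p \<in> \<rat> \<and> q \<in> \<rat> \<and> p < (q::real)}"
    by (rule countable_subset[of _ "\<rat> \<times> \<rat>"]) (auto simp: countable_rat)
  then show ?thesis unfolding nondifferentiable_along_def
    using borel_oscillation_set[OF lipschitz_on_continuous_on[OF g]] line_null_oscillation_set[OF g]
    by (intro dir_null_UN) (auto intro!: dir_null_single[where i = i])
qed

definition has_dir_deriv :: "('a::real_normed_vector \<Rightarrow> real) \<Rightarrow> 'a \<Rightarrow> 'a \<Rightarrow> real \<Rightarrow> bool" where
  "has_dir_deriv g x v D \<longleftrightarrow> ((\<lambda>t. (g (x + t *\<^sub>R v) - g x) / t) \<longlongrightarrow> D) (at 0)"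

lemma has_dir_deriv_iff:
  "has_dir_deriv g x v D \<longleftrightarrow> (\<forall>e>0. \<exists>r>0. \<forall>t. \<bar>t\<bar> < r \<longrightarrow> \<bar>g (x + t *\<^sub>R v) - g x - t * D\<bar> \<le> e * \<bar>t\<bar>)"
  (is "_ \<longleftrightarrow> ?R")
proof -
  have eq: "\<bar>(g (x + t *\<^sub>R v) - g x) / t - D\<bar> * \<bar>t\<bar> = \<bar>g (x + t *\<^sub>R v) - g x - t * D\<bar>" if "t \<noteq> 0" for t
  proof -
    have "(X / t - D) * t = X - t * D" for X
      using that by (simp add: field_simps)
    then show ?thesis by (metis abs_mult)
  qed
  show ?thesis
  proof
    assume D: "has_dir_deriv g x v D"
    show ?R
    proof (intro allI impI)
      fix e :: real assume "0 < e"
      then obtain r where r: "0 < r" "\<And>t. t \<noteq> 0 \<Longrightarrow> \<bar>t\<bar> < r \<Longrightarrow> \<bar>(g (x + t *\<^sub>R v) - g x) / t - D\<bar> < e"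
        using D unfolding has_dir_deriv_def LIM_def by (auto simp: dist_real_def)
      have "\<bar>g (x + t *\<^sub>R v) - g x - t * D\<bar> \<le> e * \<bar>t\<bar>" if "\<bar>t\<bar> < r" for t
      proof (cases "t = 0")
        case False
        have "\<bar>(g (x + t *\<^sub>R v) - g x) / t - D\<bar> * \<bar>t\<bar> \<le> e * \<bar>t\<bar>"
          using r(2)[OF False that] by (intro mult_right_mono) auto
        then show ?thesis using eq[OF False] by simp
      qed simp
      then show "\<exists>r>0. \<forall>t. \<bar>t\<bar> < r \<longrightarrow> \<bar>g (x + t *\<^sub>R v) - g x - t * D\<bar> \<le> e * \<bar>t\<bar>" using r(1) by blast
    qed
  next
    assume R: ?R
    show "has_dir_deriv g x v D" unfolding has_dir_deriv_def LIM_def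
    proof (intro allI impI)
      fix e :: real assume "0 < e"
      then obtain r where r: "0 < r" "\<And>t. \<bar>t\<bar> < r \<Longrightarrow> \<bar>g (x + t *\<^sub>R v) - g x - t * D\<bar> \<le> e / 2 * \<bar>t\<bar>"
        using R by (meson half_gt_zero)
      have "\<bar>(g (x + t *\<^sub>R v) - g x) / t - D\<bar> < e" if "t \<noteq> 0" "\<bar>t\<bar> < r" for t
      proof -
        have "\<bar>(g (x + t *\<^sub>R v) - g x) / t - D\<bar> * \<bar>t\<bar> \<le> e / 2 * \<bar>t\<bar>"
          using r(2)[OF that(2)] eq[OF that(1)] by simp
        then have "\<bar>(g (x + t *\<^sub>R v) - g x) / t - D\<bar> \<le> e / 2" using that(1) by (simp add: mult_le_cancel_right)
        then show ?thesis using \<open>0 < e\<close> by linarith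
      qed
      then show "\<exists>s>0. \<forall>t. t \<noteq> 0 \<and> dist t 0 < s \<longrightarrow> dist ((g (x + t *\<^sub>R v) - g x) / t) D < e"
        using r(1) by (auto simp: dist_real_def)
    qed
  qed
qed

lemma has_dir_deriv_unique: "has_dir_deriv g x v D \<Longrightarrow> has_dir_deriv g x v D' \<Longrightarrow> D = D'"
  unfolding has_dir_deriv_def by (rule tendsto_unique[OF at_neq_bot])

lemma diff_quotient_lipschitz:
  fixes g :: "'a::real_normed_vector \<Rightarrow> real"
  assumes g: "L-lipschitz_on UNIV g"
  shows "\<bar>(g (x + t *\<^sub>R v) - g x) / t - (g (x + t *\<^sub>R w) - g x) / t\<bar> \<le> L * norm (v - w)"
proof (cases "t = 0")
  case False
  have "\<bar>g (x + t *\<^sub>R v) - g (x + t *\<^sub>R w)\<bar> \<le> L * dist (x + t *\<^sub>R v) (x + t *\<^sub>R w)"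
    using lipschitz_onD[OF g, of "x + t *\<^sub>R v" "x + t *\<^sub>R w"] unfolding dist_real_def by blast
  also have "dist (x + t *\<^sub>R v) (x + t *\<^sub>R w) = \<bar>t\<bar> * norm (v - w)"
    by (simp add: dist_norm flip: scaleR_right_diff_distrib)
  finally have "\<bar>g (x + t *\<^sub>R v) - g (x + t *\<^sub>R w)\<bar> / \<bar>t\<bar> \<le> L * norm (v - w)"
    using False by (simp add: divide_le_eq mult_ac)
  then show ?thesis by (simp flip: diff_divide_distrib abs_divide)
qed (use lipschitz_on_nonneg[OF g] in simp)

lemma has_dir_deriv_lipschitz:
  fixes g :: "'a::real_normed_vector \<Rightarrow> real"
  assumes g: "L-lipschitz_on UNIV g" and "has_dir_deriv g x v D" "has_dir_deriv g x w D'"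
  shows "\<bar>D - D'\<bar> \<le> L * norm (v - w)"
proof -
  have "((\<lambda>t. \<bar>(g (x + t *\<^sub>R v) - g x) / t - (g (x + t *\<^sub>R w) - g x) / t\<bar>) \<longlongrightarrow> \<bar>D - D'\<bar>) (at 0)"
    using assms unfolding has_dir_deriv_def by (intro tendsto_intros)
  then show ?thesis
    by (rule tendsto_upperbound) (auto intro!: always_eventually diff_quotient_lipschitz[OF g])
qed

text \<open>
  The quotients are bounded, so without oscillation between two rational values they converge to their
  lower limit, the supremum of their eventual lower bounds.
\<close>

lemma differentiable_along_imp_dir_deriv:
  fixes g :: "'a::real_normed_vector \<Rightarrow> real"
  assumes g: "L-lipschitz_on UNIV g" and x: "x \<notin> nondifferentiable_along g v"
  shows "\<exists>D. has_dir_deriv g x v D"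
proof -
  define Q where "Q t = (g (x + t *\<^sub>R v) - g x) / t" for t
  define K where "K = L * norm v"
  have K: "\<bar>Q t\<bar> \<le> K" for t
    using diff_quotient_lipschitz[OF g, of x t v 0] by (simp add: Q_def K_def)
  define A where "A = {p. \<forall>\<^sub>F t in at 0. p \<le> Q t}"
  have "- K \<le> Q t" for t using K[of t] by linarith
  then have KA: "- K \<in> A" by (simp add: A_def)
  have ub: "p \<le> K" if "p \<in> A" for p
  proof -
    have "\<forall>\<^sub>F t in at 0. p \<le> Q t" using that by (simp add: A_def)
    then obtain t where "p \<le> Q t" using eventually_happens'[OF at_neq_bot] by blast
    then show ?thesis using K[of t] by linarith
  qed
  then have bdd: "bdd_above A" by (auto simp: bdd_above_def)
  have near: "\<exists>t. 0 < \<bar>t\<bar> \<and> \<bar>t\<bar> < 1 / (real n + 1) \<and> P t" if "\<exists>\<^sub>F t in at 0. P t" for P and n :: nat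
  proof -
    have "0 < 1 / (real n + 1)" by simp
    from that[unfolded frequently_at, rule_format, OF this]
    obtain t where "t \<noteq> 0" "dist t 0 < 1 / (real n + 1)" "P t" by auto
    then show ?thesis by (intro exI[of _ t]) (simp add: dist_real_def)
  qed
  have "(Q \<longlongrightarrow> Sup A) (at 0)"
  proof (rule order_tendstoI)
    fix y assume "y < Sup A"
    then obtain p where p: "p \<in> A" "y < p" using less_cSupD[of A y] KA by auto
    then have "\<forall>\<^sub>F t in at 0. p \<le> Q t" by (simp add: A_def)
    then show "\<forall>\<^sub>F t in at 0. y < Q t" by (rule eventually_mono) (use p in linarith)
  next
    fix y assume y: "Sup A < y"
    show "\<forall>\<^sub>F t in at 0. Q t < y"
    proof (rule ccontr)
      assume "\<not> ?thesis"
      then have hi: "\<exists>\<^sub>F t in at 0. y \<le> Q t" by (simp add: not_eventually not_less)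
      obtain p where p: "p \<in> \<rat>" "Sup A < p" "p < y" using Rats_dense_in_real[OF y] by auto
      obtain q where q: "q \<in> \<rat>" "p < q" "q < y" using Rats_dense_in_real[OF p(3)] by auto
      have "p \<notin> A" using cSup_upper[OF _ bdd, of p] p by auto
      then have lo: "\<exists>\<^sub>F t in at 0. Q t < p" by (simp add: A_def not_eventually not_le)
      have hi': "\<exists>\<^sub>F t in at 0. Q t > q" using hi by (rule frequently_elim1) (use q in linarith)
      have "x \<in> oscillation_set p q g v"
        unfolding oscillation_set_def mem_Collect_eq Q_def[symmetric]
        by (intro allI conjI near lo hi')
      then show False using x p q by (auto simp: nondifferentiable_along_def)
    qed
  qed
  then show ?thesis unfolding has_dir_deriv_def Q_def by blast
qed

lemma has_dir_deriv_imp_no_oscillation: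
  assumes "has_dir_deriv g x v D" "p < q"
  shows "x \<notin> oscillation_set p q g v"
proof
  assume x: "x \<in> oscillation_set p q g v"
  have "0 < (q - p) / 2" using assms by simp
  then obtain r where r: "0 < r" "\<And>t. t \<noteq> 0 \<Longrightarrow> \<bar>t\<bar> < r \<Longrightarrow> \<bar>(g (x + t *\<^sub>R v) - g x) / t - D\<bar> < (q - p) / 2"
    using assms(1) unfolding has_dir_deriv_def LIM_def dist_real_def by (metis diff_zero)
  obtain n :: nat where n: "1 / (real n + 1) < r" using r(1)
    by (blast dest: ex_inverse_nat_less)
  obtain t s where "0 < \<bar>t\<bar>" "\<bar>t\<bar> < 1 / (real n + 1)" "(g (x + t *\<^sub>R v) - g x) / t < p"
     "0 < \<bar>s\<bar>" "\<bar>s\<bar> < 1 / (real n + 1)" "(g (x + s *\<^sub>R v) - g x) / s > q"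
    using x unfolding oscillation_set_def by blast
  moreover from this have "\<bar>(g (x + t *\<^sub>R v) - g x) / t - D\<bar> < (q - p) / 2"
    "\<bar>(g (x + s *\<^sub>R v) - g x) / s - D\<bar> < (q - p) / 2"
    using n r(2)[of t] r(2)[of s] by force+
  ultimately show False by argo
qed

text \<open>
  The difference quotients in nearby directions are uniformly close, so oscillation in the
  direction \<open>h\<close> would cause oscillation in some direction of \<open>S\<close>.
\<close>

lemma has_dir_deriv_dense:
  fixes g :: "'a::real_normed_vector \<Rightarrow> real"
  assumes g: "L-lipschitz_on UNIV g" and dense: "closure S = UNIV"
    and S: "\<And>v. v \<in> S \<Longrightarrow> \<exists>D. has_dir_deriv g x v D"
  shows "\<exists>D. has_dir_deriv g x h D"
proof (rule differentiable_along_imp_dir_deriv[OF g])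
  have L: "0 \<le> L" by (rule lipschitz_on_nonneg[OF g])
  show "x \<notin> nondifferentiable_along g h"
  proof
    assume "x \<in> nondifferentiable_along g h"
    then obtain p q where pq: "p < q" "x \<in> oscillation_set p q g h"
      by (auto simp: nondifferentiable_along_def)
    define e where "e = (q - p) / 3"
    have e: "0 < e" using pq by (simp add: e_def)
    have "0 < e / (L + 1)" "h \<in> closure S" using e L by (simp_all add: dense)
    then obtain v where v: "v \<in> S" "dist v h < e / (L + 1)"
      unfolding closure_approachable by blast
    have "L * norm (h - v) \<le> (L + 1) * norm (h - v)" by (simp add: mult_right_mono)
    also have "\<dots> < e" using v L by (simp add: dist_norm norm_minus_commute field_simps)
    finally have close: "\<bar>(g (x + t *\<^sub>R h) - g x) / t - (g (x + t *\<^sub>R v) - g x) / t\<bar> < e" for t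
      using diff_quotient_lipschitz[OF g, of x t h v] by linarith
    have lo: "(g (x + t *\<^sub>R h) - g x) / t < p \<Longrightarrow> (g (x + t *\<^sub>R v) - g x) / t < p + e"
      and hi: "(g (x + t *\<^sub>R h) - g x) / t > q \<Longrightarrow> (g (x + t *\<^sub>R v) - g x) / t > q - e" for t
      using close[of t] by linarith+
    have "x \<in> oscillation_set (p + e) (q - e) g v"
      unfolding oscillation_set_def mem_Collect_eq
    proof (intro allI conjI)
      fix n :: nat
      obtain t s where "0 < \<bar>t\<bar>" "\<bar>t\<bar> < 1 / (real n + 1)" "(g (x + t *\<^sub>R h) - g x) / t < p"
         "0 < \<bar>s\<bar>" "\<bar>s\<bar> < 1 / (real n + 1)" "(g (x + s *\<^sub>R h) - g x) / s > q"
        using pq(2) unfolding oscillation_set_def by blast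
      then show "\<exists>t. 0 < \<bar>t\<bar> \<and> \<bar>t\<bar> < 1 / (real n + 1) \<and> (g (x + t *\<^sub>R v) - g x) / t < p + e"
        "\<exists>t. 0 < \<bar>t\<bar> \<and> \<bar>t\<bar> < 1 / (real n + 1) \<and> (g (x + t *\<^sub>R v) - g x) / t > q - e"
        using lo hi by blast+
    qed
    moreover have "p + e < q - e" using pq by (simp add: e_def field_simps)
    ultimately show False using S[OF v(1)] has_dir_deriv_imp_no_oscillation by blast
  qed
qed

definition linear_approx_set :: "('a::real_normed_vector \<Rightarrow> real) \<Rightarrow> 'a \<Rightarrow> real \<Rightarrow> real \<Rightarrow> real \<Rightarrow> 'a set" where
  "linear_approx_set g v p e r = {z. \<forall>t. \<bar>t\<bar> < r \<longrightarrow> \<bar>g (z + t *\<^sub>R v) - g z - t * p\<bar> \<le> e * \<bar>t\<bar>}"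

lemma has_dir_deriv_local_min:
  assumes D: "has_dir_deriv g x v D" and min: "\<forall>\<^sub>F t in at 0. g x \<le> g (x + t *\<^sub>R v)"
  shows "D = 0"
proof (rule antisym)
  let ?Q = "\<lambda>t. (g (x + t *\<^sub>R v) - g x) / t"
  have "(?Q \<longlongrightarrow> D) (at_right 0)"
    by (rule tendsto_mono[OF _ D[unfolded has_dir_deriv_def]]) (simp add: at_le)
  moreover have "\<forall>\<^sub>F t in at_right 0. 0 \<le> ?Q t"
    using min unfolding eventually_at_filter by (rule eventually_mono) simp
  ultimately show "0 \<le> D"
    by (rule tendsto_lowerbound) simp
  have "(?Q \<longlongrightarrow> D) (at_left 0)"
    by (rule tendsto_mono[OF _ D[unfolded has_dir_deriv_def]]) (simp add: at_le)
  moreover have "\<forall>\<^sub>F t in at_left 0. ?Q t \<le> 0"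
    using min unfolding eventually_at_filter by (rule eventually_mono) (simp add: divide_nonneg_neg)
  ultimately show "D \<le> 0"
    by (rule tendsto_upperbound) simp
qed

text \<open>
  Additivity can fail because the derivative along \<open>a\<close> is known at \<open>x\<close>, but is needed at \<open>x + t b\<close>.  If \<open>x\<close>
  lies in a set \<open>E\<close> on which the slope along \<open>a\<close> is uniformly close to \<open>\<alpha>\<close>, it suffices that \<open>E\<close> has
  points within \<open>o(t)\<close> of \<open>x + t b\<close>.  This says that the distance function of \<open>E\<close>, which is minimal at
  \<open>x\<close>, has derivative \<open>0\<close> along \<open>b\<close>; and this distance function is Lipschitz, so it is differentiable
  along \<open>b\<close> off a set that is null along \<open>b\<close>.
\<close>

lemma has_dir_deriv_add:
  fixes g :: "'a::real_normed_vector \<Rightarrow> real"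
  assumes g: "L-lipschitz_on UNIV g"
    and a: "has_dir_deriv g x a \<alpha>" and b: "has_dir_deriv g x b \<beta>"
    and E: "\<And>p e k. p \<in> \<rat> \<Longrightarrow> e \<in> \<rat> \<Longrightarrow>
       \<exists>D. has_dir_deriv (\<lambda>y. infdist y (linear_approx_set g a p e (1 / (real k + 1)))) x b D"
  shows "has_dir_deriv g x (a + b) (\<alpha> + \<beta>)"
  unfolding has_dir_deriv_iff
proof (intro allI impI)
  fix e0 :: real assume e0: "0 < e0"
  have L: "0 \<le> L" by (rule lipschitz_on_nonneg[OF g])
  have lip: "\<bar>g y - g z\<bar> \<le> L * dist y z" for y z
    using lipschitz_onD[OF g, of y z] by (simp add: dist_real_def)
  have "0 < e0 / (2 * L + 3)" using e0 L by simp
  then obtain e where e: "e \<in> \<rat>" "0 < e" "e < e0 / (2 * L + 3)" using Rats_dense_in_real by blast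
  have esmall: "(2 * L + 3) * e < e0" using e(3) L by (simp add: pos_less_divide_eq mult.commute)
  obtain p where p: "p \<in> \<rat>" "\<alpha> < p" "p < \<alpha> + e" using Rats_dense_in_real[of \<alpha> "\<alpha> + e"] e(2) by auto
  obtain r1 where r1: "0 < r1" "\<And>t. \<bar>t\<bar> < r1 \<Longrightarrow> \<bar>g (x + t *\<^sub>R a) - g x - t * \<alpha>\<bar> \<le> (\<alpha> + e - p) * \<bar>t\<bar>"
    using a p unfolding has_dir_deriv_iff by (metis diff_gt_0_iff_gt)
  obtain k :: nat where k: "1 / (real k + 1) < r1" using r1(1)
    by (blast dest: ex_inverse_nat_less)
  define E where "E = linear_approx_set g a p e (1 / (real k + 1))"
  have xE: "x \<in> E" unfolding E_def linear_approx_set_def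
  proof (intro CollectI allI impI)
    fix t :: real assume "\<bar>t\<bar> < 1 / (real k + 1)"
    then have "\<bar>g (x + t *\<^sub>R a) - g x - t * \<alpha>\<bar> \<le> (\<alpha> + e - p) * \<bar>t\<bar>" using r1 k by simp
    moreover have "\<bar>t * \<alpha> - t * p\<bar> = (p - \<alpha>) * \<bar>t\<bar>" using p by (simp add: abs_mult flip: right_diff_distrib)
    ultimately have "\<bar>g (x + t *\<^sub>R a) - g x - t * p\<bar> \<le> (\<alpha> + e - p) * \<bar>t\<bar> + (p - \<alpha>) * \<bar>t\<bar>" by linarith
    also have "\<dots> = e * \<bar>t\<bar>" by (simp add: algebra_simps)
    finally show "\<bar>g (x + t *\<^sub>R a) - g x - t * p\<bar> \<le> e * \<bar>t\<bar>" .
  qed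
  have "has_dir_deriv (\<lambda>y. infdist y E) x b 0"
    using E[OF p(1) e(1), of k] has_dir_deriv_local_min[of "\<lambda>y. infdist y E" x b] xE
    unfolding E_def[symmetric] by (auto simp: infdist_nonneg)
  then obtain r2 where r2: "0 < r2" "\<And>t. \<bar>t\<bar> < r2 \<Longrightarrow> \<bar>infdist (x + t *\<^sub>R b) E\<bar> \<le> e / 2 * \<bar>t\<bar>"
    unfolding has_dir_deriv_iff using e(2) xE by (metis half_gt_zero infdist_zero diff_0_right mult_zero_right)
  obtain r3 where r3: "0 < r3" "\<And>t. \<bar>t\<bar> < r3 \<Longrightarrow> \<bar>g (x + t *\<^sub>R b) - g x - t * \<beta>\<bar> \<le> e * \<bar>t\<bar>"
    using b e(2) unfolding has_dir_deriv_iff by metis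
  define r where "r = min (1 / (real k + 1)) (min r2 r3)"
  have "\<bar>g (x + t *\<^sub>R (a + b)) - g x - t * (\<alpha> + \<beta>)\<bar> \<le> e0 * \<bar>t\<bar>" if t: "\<bar>t\<bar> < r" for t
  proof (cases "t = 0")
    case False
    have "infdist (x + t *\<^sub>R b) E \<le> e / 2 * \<bar>t\<bar>" using r2(2)[of t] t by (simp add: r_def)
    also have "\<dots> < e * \<bar>t\<bar>" using e(2) False by simp
    finally obtain z where z: "z \<in> E" "dist (x + t *\<^sub>R b) z < e * \<bar>t\<bar>"
      using xE by (auto simp: infdist_def cINF_less_iff split: if_splits)
    have "\<bar>g (z + t *\<^sub>R a) - g z - t * p\<bar> \<le> e * \<bar>t\<bar>"
      using z(1) t unfolding E_def linear_approx_set_def r_def by simp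
    moreover have Lz: "L * dist (x + t *\<^sub>R b) z \<le> L * (e * \<bar>t\<bar>)" using z(2) L by (intro mult_left_mono) auto
    moreover have "\<bar>g (x + t *\<^sub>R b) - g z\<bar> \<le> L * dist (x + t *\<^sub>R b) z" by (rule lip)
    moreover have "\<bar>g (x + t *\<^sub>R (a + b)) - g (z + t *\<^sub>R a)\<bar> \<le> L * dist (x + t *\<^sub>R b) z"
      using lip[of "x + t *\<^sub>R (a + b)" "z + t *\<^sub>R a"] by (simp add: scaleR_right_distrib dist_norm algebra_simps)
    moreover have "\<bar>g (x + t *\<^sub>R b) - g x - t * \<beta>\<bar> \<le> e * \<bar>t\<bar>" using r3(2)[of t] t by (simp add: r_def)
    moreover have "\<bar>t * p - t * \<alpha>\<bar> \<le> e * \<bar>t\<bar>"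
    proof -
      have "\<bar>t * p - t * \<alpha>\<bar> = \<bar>t\<bar> * (p - \<alpha>)" using p by (simp add: abs_mult flip: right_diff_distrib)
      also have "\<dots> \<le> \<bar>t\<bar> * e" using p by (intro mult_left_mono) auto
      finally show ?thesis by (simp add: mult.commute)
    qed
    ultimately have "\<bar>g (x + t *\<^sub>R (a + b)) - g x - (t * \<alpha> + t * \<beta>)\<bar> \<le> 2 * (L * (e * \<bar>t\<bar>)) + 3 * (e * \<bar>t\<bar>)"
      by linarith
    also have "\<dots> = ((2 * L + 3) * e) * \<bar>t\<bar>" by (simp add: algebra_simps)
    also have "\<dots> \<le> e0 * \<bar>t\<bar>" using esmall by (intro mult_right_mono) auto
    finally show ?thesis by (simp add: distrib_left)
  qed simp
  moreover have "0 < r" using r2 r3 by (simp add: r_def)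
  ultimately show "\<exists>r>0. \<forall>t. \<bar>t\<bar> < r \<longrightarrow> \<bar>g (x + t *\<^sub>R (a + b)) - g x - t * (\<alpha> + \<beta>)\<bar> \<le> e0 * \<bar>t\<bar>" by blast
qed

lemma has_dir_deriv_scale:
  assumes "has_dir_deriv g x v D"
  shows "has_dir_deriv g x (c *\<^sub>R v) (c * D)"
proof (cases "c = 0")
  case False
  show ?thesis unfolding has_dir_deriv_iff
  proof (intro allI impI)
    fix e :: real assume "0 < e"
    then have "0 < e / \<bar>c\<bar>" using False by simp
    then obtain r where r: "0 < r" "\<And>t. \<bar>t\<bar> < r \<Longrightarrow> \<bar>g (x + t *\<^sub>R v) - g x - t * D\<bar> \<le> e / \<bar>c\<bar> * \<bar>t\<bar>"
      using assms unfolding has_dir_deriv_iff by metis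
    show "\<exists>r>0. \<forall>t. \<bar>t\<bar> < r \<longrightarrow> \<bar>g (x + t *\<^sub>R c *\<^sub>R v) - g x - t * (c * D)\<bar> \<le> e * \<bar>t\<bar>"
    proof (intro exI[of _ "r / \<bar>c\<bar>"] conjI allI impI)
      fix t assume "\<bar>t\<bar> < r / \<bar>c\<bar>"
      then have "\<bar>t * c\<bar> < r" using False by (simp add: abs_mult pos_less_divide_eq)
      from r(2)[OF this] show "\<bar>g (x + t *\<^sub>R c *\<^sub>R v) - g x - t * (c * D)\<bar> \<le> e * \<bar>t\<bar>"
        using False by (simp add: abs_mult mult_ac)
    qed (use r False in simp)
  qed
qed (simp add: has_dir_deriv_def)

text \<open>
  Only directional derivatives of countably many Lipschitz functions are used: \<open>g\<close> itself along each
  \<open>d i\<close>, and the distance functions of the sets of almost linear growth, with rational parameters.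
\<close>

theorem lipschitz_gateaux_differentiable:
  fixes g :: "'a::real_normed_vector \<Rightarrow> real"
  assumes g: "L-lipschitz_on UNIV g" and dense: "closure (range d) = UNIV"
  shows "dir_null d {x. \<not> gateaux_differentiable_at g x}"
proof -
  define I where "I i p e k = (\<lambda>y. infdist y (linear_approx_set g (d i) p e (1 / (real k + 1))))"
    for i :: nat and p e :: real and k :: nat
  have I: "1-lipschitz_on UNIV (I i p e k)" for i p e k
    unfolding I_def by (intro lipschitz_onI) (auto simp: dist_real_def dist_commute infdist_triangle_abs)
  define N where "N = (\<Union>i. nondifferentiable_along g (d i)) \<union>
     (\<Union>i. \<Union>j. \<Union>p\<in>\<rat>. \<Union>e\<in>\<rat>. \<Union>k. nondifferentiable_along (I i p e k) (d j))"
  have "dir_null d N" unfolding N_def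
    by (intro dir_null_Un dir_null_UN_nat dir_null_UN countable_rat dir_null_nondifferentiable_along[OF g] dir_null_nondifferentiable_along[OF I])
  moreover have "gateaux_differentiable_at g x" if x: "x \<notin> N" for x
  proof -
    have L: "0 \<le> L" by (rule lipschitz_on_nonneg[OF g])
    have "\<exists>D. has_dir_deriv g x v D" if "v \<in> range d" for v
      using that x differentiable_along_imp_dir_deriv[OF g, of x v] unfolding N_def by blast
    then have "\<exists>D. has_dir_deriv g x h D" for h
      using has_dir_deriv_dense[OF g dense] by blast
    then obtain D where D: "\<And>h. has_dir_deriv g x h (D h)" by metis
    have Dlip: "\<bar>D v - D w\<bar> \<le> L * norm (v - w)" for v w
      by (rule has_dir_deriv_lipschitz[OF g D D])
    have Dscale: "D (c *\<^sub>R v) = c * D v" for c v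
      by (rule has_dir_deriv_unique[OF D has_dir_deriv_scale[OF D]])
    have nd: "x \<notin> nondifferentiable_along (I i p e k) (d j)" if "p \<in> \<rat>" "e \<in> \<rat>" for i j p e k
      using x that by (simp add: N_def)
    have Dadd: "D (d i + d j) = D (d i) + D (d j)" for i j
    proof -
      have "has_dir_deriv g x (d i + d j) (D (d i) + D (d j))"
      proof (rule has_dir_deriv_add[OF g D D])
        fix p e :: real and k :: nat assume "p \<in> \<rat>" "e \<in> \<rat>"
        then have "\<exists>D. has_dir_deriv (I i p e k) x (d j) D"
          by (intro differentiable_along_imp_dir_deriv[OF I] nd)
        then show "\<exists>D. has_dir_deriv (\<lambda>y. infdist y (linear_approx_set g (d i) p e (1 / (real k + 1)))) x (d j) D"
          by (simp only: I_def)
      qed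
      then show ?thesis by (rule has_dir_deriv_unique[OF D])
    qed
    have Dadd': "D (v + w) = D v + D w" for v w
    proof -
      have "\<bar>D (v + w) - (D v + D w)\<bar> \<le> 0 + e" if e: "0 < e" for e
      proof -
        define r where "r = e / 4 / (L + 1)"
        have "M * (e / 4 / M) = e / 4" if "0 < M" for M using that by simp
        from this[of "L + 1"] have r: "0 < r" "(L + 1) * r = e / 4"
          unfolding r_def using e L by auto
        have "\<exists>i. norm (u - d i) < r" for u
        proof -
          have "u \<in> closure (range d)" by (simp add: dense)
          then show ?thesis using r(1) unfolding closure_approachable
            by (auto simp: dist_norm norm_minus_commute)
        qed
        then obtain i j where ij: "norm (v - d i) < r" "norm (w - d j) < r" by blast
        have n: "norm (v + w - (d i + d j)) \<le> 2 * r"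
          using norm_triangle_ineq[of "v - d i" "w - d j"] ij by (simp add: algebra_simps)
        have "\<bar>D (v + w) - D (d i + d j)\<bar> \<le> L * (2 * r)"
          using Dlip[of "v + w" "d i + d j"] mult_left_mono[OF n L] by linarith
        moreover have "\<bar>D v - D (d i)\<bar> \<le> L * r" "\<bar>D w - D (d j)\<bar> \<le> L * r"
          using Dlip[of v "d i"] mult_left_mono[OF less_imp_le[OF ij(1)] L]
            Dlip[of w "d j"] mult_left_mono[OF less_imp_le[OF ij(2)] L] by linarith+
        ultimately have "\<bar>D (v + w) - (D v + D w)\<bar> \<le> L * (2 * r) + L * r + L * r"
          using Dadd[of i j] by linarith
        also have "\<dots> \<le> (L + 1) * (4 * r)" using r by (simp add: algebra_simps)
        also have "\<dots> = e" using r(2) by simp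
        finally show ?thesis by simp
      qed
      then have "\<bar>D (v + w) - (D v + D w)\<bar> \<le> 0" by (rule field_le_epsilon)
      then show ?thesis by simp
    qed
    have "bounded_linear D"
    proof (rule bounded_linear_intro)
      show "norm (D v) \<le> norm v * L" for v
        using Dlip[of v 0] Dscale[of 0 0] by (simp add: mult.commute)
    qed (auto simp: Dadd' Dscale)
    then have "has_gateaux_derivative g (Blinfun D) x"
      unfolding has_gateaux_derivative_def using D
      by (simp add: bounded_linear_Blinfun_apply has_dir_deriv_def)
    then show ?thesis unfolding gateaux_differentiable_at_def by blast
  qed
  ultimately show ?thesis by (elim dir_null_subset) blast
qed

section \<open>Functions monotone along a cone\<close>

text \<open>
  The integer \<open>n\<close> bounds both the scale and the constant of the pointwise Lipschitz condition.  A limit of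
  such points is a point of continuity, so the set is closed for every function \<open>f\<close>, measurable or not.
\<close>

definition lipschitz_points :: "('a::real_normed_vector \<Rightarrow> real) \<Rightarrow> nat \<Rightarrow> 'a set" where
  "lipschitz_points f n = {x. \<forall>h. norm h < 1 / (real n + 1) \<longrightarrow> \<bar>f (x + h) - f x\<bar> \<le> (real n + 1) * norm h}"

lemma lipschitz_points_tendsto:
  assumes X: "\<And>k::nat. X k \<in> lipschitz_points f n" and lim: "X \<longlonglongrightarrow> x" and h: "norm h < 1 / (real n + 1)"
  shows "(\<lambda>k. f (X k)) \<longlonglongrightarrow> f x" "\<bar>f (x + h) - f x\<bar> \<le> (real n + 1) * norm h"
proof -
  have near: "\<forall>\<^sub>F k in sequentially. \<bar>f (x + w) - f (X k)\<bar> \<le> (real n + 1) * norm (x + w - X k)"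
    if w: "norm w < 1 / (real n + 1)" for w
  proof -
    have "(\<lambda>k. norm (x + w - X k)) \<longlonglongrightarrow> norm (x + w - x)" by (intro tendsto_intros lim)
    then have "\<forall>\<^sub>F k in sequentially. norm (x + w - X k) < 1 / (real n + 1)"
      by (rule order_tendstoD) (use w in simp)
    then show ?thesis
    proof (rule eventually_mono)
      fix k assume "norm (x + w - X k) < 1 / (real n + 1)"
      then have "\<bar>f (X k + (x + w - X k)) - f (X k)\<bar> \<le> (real n + 1) * norm (x + w - X k)"
        using X[of k] unfolding lipschitz_points_def by blast
      then show "\<bar>f (x + w) - f (X k)\<bar> \<le> (real n + 1) * norm (x + w - X k)" by simp
    qed
  qed
  have "(\<lambda>k. f (X k) - f x) \<longlonglongrightarrow> 0"
  proof (rule Lim_null_comparison)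
    show "\<forall>\<^sub>F k in sequentially. norm (f (X k) - f x) \<le> (real n + 1) * norm (x - X k)"
      using near[of 0] by (rule eventually_mono) (auto simp: abs_minus_commute)
    have "(\<lambda>k. (real n + 1) * norm (x - X k)) \<longlonglongrightarrow> (real n + 1) * norm (x - x)" by (intro tendsto_intros lim)
    then show "(\<lambda>k. (real n + 1) * norm (x - X k)) \<longlonglongrightarrow> 0" by simp
  qed
  then show lf: "(\<lambda>k. f (X k)) \<longlonglongrightarrow> f x" by (simp add: LIM_zero_iff)
  have "(\<lambda>k. (real n + 1) * norm (x + h - X k)) \<longlonglongrightarrow> (real n + 1) * norm (x + h - x)"
    by (intro tendsto_intros lim)
  moreover have "(\<lambda>k. \<bar>f (x + h) - f (X k)\<bar>) \<longlonglongrightarrow> \<bar>f (x + h) - f x\<bar>" by (intro tendsto_intros lf)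
  ultimately have "\<bar>f (x + h) - f x\<bar> \<le> (real n + 1) * norm (x + h - x)"
    by (rule tendsto_le[OF sequentially_bot]) (rule near[OF h])
  then show "\<bar>f (x + h) - f x\<bar> \<le> (real n + 1) * norm h" by simp
qed

lemma closed_lipschitz_points: "closed (lipschitz_points f n)"
  unfolding closed_sequential_limits
proof (intro allI impI, elim conjE)
  fix X x assume "\<forall>k. X k \<in> lipschitz_points f n" "X \<longlonglongrightarrow> x"
  then show "x \<in> lipschitz_points f n"
    using lipschitz_points_tendsto(2)[of X f n x] unfolding lipschitz_points_def[of f n] by blast
qed

lemma lipschitz_points_isCont:
  assumes "x \<in> lipschitz_points f n"
  shows "isCont f x"
  unfolding isCont_iff
proof (rule LIM_zero_cancel, rule Lim_null_comparison)
  have "0 < 1 / (real n + 1)" by simp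
  then show "\<forall>\<^sub>F h in at 0. norm (f (x + h) - f x) \<le> (real n + 1) * norm h"
    unfolding eventually_at using assms
    by (intro exI[of _ "1 / (real n + 1)"]) (auto simp: lipschitz_points_def)
  have "((\<lambda>h. (real n + 1) * norm h) \<longlongrightarrow> (real n + 1) * norm (0::'a)) (at (0::'a))"
    by (rule tendsto_mult[OF tendsto_const tendsto_norm[OF tendsto_ident_at]])
  then show "((\<lambda>h. (real n + 1) * norm h) \<longlongrightarrow> 0) (at (0::'a))" by simp
qed

text \<open>
  The largest \<open>C\<close>-Lipschitz minorant of \<open>f\<close> on \<open>B\<close>, defined on the whole space by the formula of McShane
  and Whitney.
\<close>

definition lower_envelope :: "real \<Rightarrow> 'a::metric_space set \<Rightarrow> ('a \<Rightarrow> real) \<Rightarrow> 'a \<Rightarrow> real" where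
  "lower_envelope C B f x = (INF y\<in>B. f y + C * dist x y)"

lemma lower_envelope_props:
  fixes f :: "'a::metric_space \<Rightarrow> real"
  assumes C: "0 \<le> C" and bdd: "\<And>y. y \<in> B \<Longrightarrow> b \<le> f y" and ne: "B \<noteq> {}"
  shows lower_envelope_lipschitz: "C-lipschitz_on UNIV (lower_envelope C B f)"
    and lower_envelope_le: "x \<in> B \<Longrightarrow> lower_envelope C B f x \<le> f x"
    and lower_envelope_eq: "x \<in> B \<Longrightarrow> (\<And>y. y \<in> B \<Longrightarrow> f x \<le> f y + C * dist x y) \<Longrightarrow> lower_envelope C B f x = f x"
proof -
  have bb: "bdd_below ((\<lambda>y. f y + C * dist x y) ` B)" for x
    using bdd C by (intro bdd_belowI[of _ b]) (force intro: add_increasing2)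
  have step: "lower_envelope C B f x \<le> lower_envelope C B f x' + C * dist x x'" for x x'
  proof -
    have "lower_envelope C B f x - C * dist x x' \<le> f y + C * dist x' y" if "y \<in> B" for y
    proof -
      have "lower_envelope C B f x \<le> f y + C * dist x y"
        unfolding lower_envelope_def by (rule cINF_lower[OF bb that])
      also have "\<dots> \<le> f y + C * (dist x x' + dist x' y)" using C by (intro add_left_mono mult_left_mono dist_triangle)
      finally show ?thesis by (simp add: algebra_simps)
    qed
    then have "lower_envelope C B f x - C * dist x x' \<le> lower_envelope C B f x'"
      unfolding lower_envelope_def[of C B f x'] by (intro cINF_greatest ne)
    then show ?thesis by simp
  qed
  show "C-lipschitz_on UNIV (lower_envelope C B f)"
  proof (rule lipschitz_onI[OF _ C])
    fix x y show "dist (lower_envelope C B f x) (lower_envelope C B f y) \<le> C * dist x y"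
      using step[of x y] step[of y x] by (simp add: dist_real_def dist_commute abs_le_iff)
  qed
  show le: "x \<in> B \<Longrightarrow> lower_envelope C B f x \<le> f x" for x
    using cINF_lower[OF bb, of x x] by (simp add: lower_envelope_def)
  show "lower_envelope C B f x = f x" if "x \<in> B" "\<And>y. y \<in> B \<Longrightarrow> f x \<le> f y + C * dist x y"
    using le[OF that(1)] that(2) unfolding lower_envelope_def
    by (intro antisym cINF_greatest ne) auto
qed

lemma has_gateaux_derivative_iff_dir: "has_gateaux_derivative f D x \<longleftrightarrow> (\<forall>h. has_dir_deriv f x h (D h))"
  by (simp add: has_gateaux_derivative_def has_dir_deriv_def)

lemma eventually_line_in_open:
  fixes x h :: "'a::real_normed_vector"
  assumes "open B" "x \<in> B"
  shows "\<forall>\<^sub>F t in nhds (0::real). x + t *\<^sub>R h \<in> B"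
proof -
  have "((\<lambda>t::real. x + t *\<^sub>R h) \<longlongrightarrow> x + 0 *\<^sub>R h) (nhds 0)"
    by (intro tendsto_intros filterlim_ident)
  then show ?thesis using assms by (auto dest: topological_tendstoD)
qed

text \<open>
  The difference \<open>v - u\<close> has a minimum at \<open>x\<close>, so \<open>u\<close> and \<open>v\<close> have the same derivative there.
\<close>

lemma gateaux_squeeze:
  fixes f u v :: "'a::real_normed_vector \<Rightarrow> real"
  assumes B: "open B" "x \<in> B" and uf: "\<And>y. y \<in> B \<Longrightarrow> u y \<le> f y" and fv: "\<And>y. y \<in> B \<Longrightarrow> f y \<le> v y"
    and eq: "u x = f x" "v x = f x"
    and u: "gateaux_differentiable_at u x" and v: "gateaux_differentiable_at v x"
  shows "gateaux_differentiable_at f x"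
proof -
  obtain D D' where D: "\<And>h. has_dir_deriv u x h (blinfun_apply D h)" and D': "\<And>h. has_dir_deriv v x h (blinfun_apply D' h)"
    using u v unfolding gateaux_differentiable_at_def has_gateaux_derivative_iff_dir by blast
  have "has_dir_deriv f x h (D h)" for h
  proof -
    have inB: "\<forall>\<^sub>F t in nhds 0. x + t *\<^sub>R h \<in> B" by (rule eventually_line_in_open[OF B])
    have "has_dir_deriv (\<lambda>y. v y - u y) x h (D' h - D h)"
      using tendsto_diff[OF D'[of h, unfolded has_dir_deriv_def] D[of h, unfolded has_dir_deriv_def]]
      unfolding has_dir_deriv_def by (simp add: diff_divide_distrib add_divide_distrib algebra_simps)
    moreover have "\<forall>\<^sub>F t in at 0. v x - u x \<le> v (x + t *\<^sub>R h) - u (x + t *\<^sub>R h)"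
      using inB unfolding eventually_at_filter
      by (rule eventually_mono) (use eq uf fv in force)
    ultimately have DD: "D' h = D h" using has_dir_deriv_local_min by force
    show ?thesis unfolding has_dir_deriv_iff
    proof (intro allI impI)
      fix e :: real assume e: "0 < e"
      obtain r1 where r1: "0 < r1" "\<And>t. \<bar>t\<bar> < r1 \<Longrightarrow> \<bar>u (x + t *\<^sub>R h) - u x - t * D h\<bar> \<le> e * \<bar>t\<bar>"
        using D[of h] e unfolding has_dir_deriv_iff by metis
      obtain r2 where r2: "0 < r2" "\<And>t. \<bar>t\<bar> < r2 \<Longrightarrow> \<bar>v (x + t *\<^sub>R h) - v x - t * D h\<bar> \<le> e * \<bar>t\<bar>"
        using D'[of h] e unfolding has_dir_deriv_iff DD by metis
      obtain r3 where r3: "0 < r3" "\<And>t. \<bar>t\<bar> < r3 \<Longrightarrow> x + t *\<^sub>R h \<in> B"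
        using inB unfolding eventually_nhds_metric by (auto simp: dist_real_def)
      have "\<bar>f (x + t *\<^sub>R h) - f x - t * D h\<bar> \<le> e * \<bar>t\<bar>" if t: "\<bar>t\<bar> < min r1 (min r2 r3)" for t
      proof -
        have "u (x + t *\<^sub>R h) \<le> f (x + t *\<^sub>R h)" "f (x + t *\<^sub>R h) \<le> v (x + t *\<^sub>R h)"
          using t r3(2)[of t] uf fv by auto
        moreover have "\<bar>u (x + t *\<^sub>R h) - f x - t * D h\<bar> \<le> e * \<bar>t\<bar>" "\<bar>v (x + t *\<^sub>R h) - f x - t * D h\<bar> \<le> e * \<bar>t\<bar>"
          using t r1(2)[of t] r2(2)[of t] eq by auto
        ultimately show ?thesis by linarith
      qed
      then show "\<exists>r>0. \<forall>t. \<bar>t\<bar> < r \<longrightarrow> \<bar>f (x + t *\<^sub>R h) - f x - t * D h\<bar> \<le> e * \<bar>t\<bar>"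
        using r1(1) r2(1) r3(1) by (intro exI[of _ "min r1 (min r2 r3)"]) auto
    qed
  qed
  then show ?thesis unfolding gateaux_differentiable_at_def has_gateaux_derivative_iff_dir by blast
qed

lemma gateaux_differentiable_uminus:
  assumes "gateaux_differentiable_at f x"
  shows "gateaux_differentiable_at (\<lambda>y. - f y) x"
proof -
  obtain D where D: "\<And>h. has_dir_deriv f x h (blinfun_apply D h)"
    using assms unfolding gateaux_differentiable_at_def has_gateaux_derivative_iff_dir by blast
  have "has_dir_deriv (\<lambda>y. - f y) x h (blinfun_apply (- D) h)" for h
    using tendsto_minus[OF D[of h, unfolded has_dir_deriv_def]]
    unfolding has_dir_deriv_def by (simp add: uminus_blinfun.rep_eq minus_divide_left)
  then show ?thesis unfolding gateaux_differentiable_at_def has_gateaux_derivative_iff_dir by blast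
qed

text \<open>
  On a ball of diameter below the scale of the Lipschitz points, the lower and upper Lipschitz envelopes of
  \<open>f\<close> agree with \<open>f\<close> at these points, and enclose \<open>f\<close> on the ball.
\<close>

theorem stepanov_gateaux:
  fixes f :: "'a::real_normed_vector \<Rightarrow> real"
  assumes dense: "closure (range d) = UNIV"
  shows "dir_null d {x \<in> lipschitz_points f n. \<not> gateaux_differentiable_at f x}"
proof -
  define C where "C = real n + 1"
  have C: "0 < C" by (simp add: C_def)
  define B where "B i = ball (d i) (1 / (2 * C))" for i
  define S where "S i = lipschitz_points f n \<inter> B i" for i
  have SB: "\<bar>f y - f x\<bar> \<le> C * dist x y" "C * dist x y \<le> 1" if x: "x \<in> S i" and y: "y \<in> B i" for x y i
  proof -
    have "dist x y \<le> dist (d i) x + dist (d i) y" by (rule dist_triangle3)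
    also have "\<dots> < 1 / (2 * C) + 1 / (2 * C)" using x y by (intro add_strict_mono) (auto simp: S_def B_def)
    also have "\<dots> = 1 / C" by (simp add: field_simps)
    finally have lt: "dist x y < 1 / C" .
    then show "C * dist x y \<le> 1" using C by (simp add: field_simps)
    have "norm (y - x) < 1 / (real n + 1)" using lt by (simp add: dist_norm norm_minus_commute C_def)
    then have "\<bar>f (x + (y - x)) - f x\<bar> \<le> C * norm (y - x)"
      using x unfolding S_def lipschitz_points_def C_def by blast
    then show "\<bar>f y - f x\<bar> \<le> C * dist x y" by (simp add: dist_norm norm_minus_commute)
  qed
  have "dir_null d {x \<in> S i. \<not> gateaux_differentiable_at f x}" for i
  proof (cases "S i = {}")
    case True
    then show ?thesis using dir_null_single[of "{}" d 0] by (simp add: line_null_def)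
  next
    case False
    then obtain x0 where x0: "x0 \<in> S i" by blast
    then have ne: "B i \<noteq> {}" by (auto simp: S_def)
    have lo: "f x0 - 1 \<le> f y" and hi: "- f x0 - 1 \<le> - f y" if "y \<in> B i" for y
      using SB[OF x0 that] by linarith+
    define u where "u = lower_envelope C (B i) f"
    define w where "w = lower_envelope C (B i) (\<lambda>y. - f y)"
    have C0: "0 \<le> C" using C by simp
    have lip: "C-lipschitz_on UNIV u" "C-lipschitz_on UNIV w"
      unfolding u_def w_def using lower_envelope_lipschitz[OF C0 lo ne] lower_envelope_lipschitz[OF C0 hi ne] by auto
    have le: "u y \<le> f y" "f y \<le> - w y" if "y \<in> B i" for y
      using lower_envelope_le[where f = f, OF C0 lo ne that]
        lower_envelope_le[where f = "\<lambda>y. - f y", OF C0 hi ne that] by (auto simp: u_def w_def)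
    have eq: "u x = f x" "w x = - f x" if x: "x \<in> S i" for x
    proof -
      have xB: "x \<in> B i" using x by (simp add: S_def)
      have "f x \<le> f y + C * dist x y" "- f x \<le> - f y + C * dist x y" if "y \<in> B i" for y
        using SB(1)[OF x that] by linarith+
      then show "u x = f x" "w x = - f x" unfolding u_def w_def
        by (auto intro!: lower_envelope_eq[OF C0 lo ne xB] lower_envelope_eq[OF C0 hi ne xB])
    qed
    have "gateaux_differentiable_at f x" if x: "x \<in> S i" and u: "gateaux_differentiable_at u x" and w: "gateaux_differentiable_at w x" for x
    proof (rule gateaux_squeeze[of "B i" x u f "\<lambda>y. - w y"])
      show "open (B i)" "x \<in> B i" using x by (auto simp: B_def S_def)
    qed (use le eq[OF x] u gateaux_differentiable_uminus[OF w] in auto)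
    then have "{x \<in> S i. \<not> gateaux_differentiable_at f x} \<subseteq>
        {x. \<not> gateaux_differentiable_at u x} \<union> {x. \<not> gateaux_differentiable_at w x}" by blast
    then show ?thesis
      using dir_null_Un[OF lipschitz_gateaux_differentiable[OF lip(1) dense] lipschitz_gateaux_differentiable[OF lip(2) dense]]
        dir_null_subset by blast
  qed
  then have "dir_null d (\<Union>i. {x \<in> S i. \<not> gateaux_differentiable_at f x})" by (rule dir_null_UN_nat)
  moreover have "\<exists>i. x \<in> B i" for x
  proof -
    have "x \<in> closure (range d)" "0 < 1 / (2 * C)" using dense C by auto
    then show ?thesis unfolding closure_approachable by (auto simp: B_def)
  qed
  ultimately show ?thesis by (elim dir_null_subset) (auto simp: S_def)
qed

text \<open>
  For small \<open>h\<close> the vectors \<open>s e \<plusminus> h\<close> lie in the cone when \<open>s\<close> is a suitable multiple of \<open>norm h\<close>.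
  Hence \<open>f (y - s e) \<le> f (y + h) \<le> f (y + s e)\<close>, and the Lipschitz condition at \<open>y\<close> is controlled by
  the monotone function \<open>f\<close> on the line through \<open>y\<close> in the direction \<open>e\<close>.
\<close>

lemma cone_monotone_lipschitz_points:
  fixes f :: "'a::real_normed_vector \<Rightarrow> real"
  assumes V: "open V" and \<rho>: "0 < \<rho>"
    and mono: "\<And>y u t. y \<in> V \<Longrightarrow> norm (u - d i) < \<rho> \<Longrightarrow> 0 \<le> t \<Longrightarrow> f y \<le> f (y + t *\<^sub>R u)"
  shows "dir_null d (V - (\<Union>n. lipschitz_points f n))"
proof (rule dir_null_single)
  show "V - (\<Union>n. lipschitz_points f n) \<in> sets borel"
    using V closed_lipschitz_points by (intro sets.Diff sets.countable_UN) (auto intro: borel_closed borel_open)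
  define e where "e = d i"
  show "line_null (V - (\<Union>n. lipschitz_points f n)) (d i)"
    unfolding line_null_def e_def[symmetric]
  proof
    fix x
    define S where "S = {t. x + t *\<^sub>R e \<in> V - (\<Union>n. lipschitz_points f n)}"
    show "negligible {t. x + t *\<^sub>R e \<in> V - (\<Union>n. lipschitz_points f n)}"
      unfolding S_def[symmetric]
    proof (subst locally_negligible_alt, rule ballI)
      fix t0 assume t0: "t0 \<in> S"
      have "\<forall>\<^sub>F t in nhds 0. (x + t0 *\<^sub>R e) + t *\<^sub>R e \<in> V"
        by (rule eventually_line_in_open[OF V]) (use t0 in \<open>simp add: S_def\<close>)
      then obtain \<eta>' where \<eta>': "0 < \<eta>'" "\<And>t. \<bar>t\<bar> < \<eta>' \<Longrightarrow> (x + t0 *\<^sub>R e) + t *\<^sub>R e \<in> V"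
        unfolding eventually_nhds_metric by (auto simp: dist_real_def)
      define a where "a = t0 - \<eta>' / 2"
      define b where "b = t0 + \<eta>' / 2"
      have inV: "x + t *\<^sub>R e \<in> V" if "t \<in> {a..b}" for t
        using \<eta>'(2)[of "t - t0"] \<eta>'(1) that by (auto simp: a_def b_def algebra_simps abs_less_iff)
      define g where "g t = f (x + t *\<^sub>R e)" for t
      have step: "g r \<le> g s" if "r \<in> {a..b}" "r \<le> s" for r s
        using mono[OF inV[OF that(1)], of e "s - r"] \<rho> that(2) by (simp add: g_def e_def algebra_simps)
      have gm: "mono_on {a..b} g" using step by (auto intro!: mono_onI)
      have bad: "\<exists>s. 0 < s \<and> s < 1 / (real n + 1) \<and> a \<le> t - s \<and> t + s \<le> b \<and> real n * s < g (t + s) - g (t - s)"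
        if t: "t \<in> S" "t \<in> {a<..<b}" for t and n :: nat
      proof (rule ccontr)
        assume no: "\<not> ?thesis"
        define y where "y = x + t *\<^sub>R e"
        have yV: "y \<in> V" using t by (simp add: S_def y_def)
        obtain r where r: "0 < r" "ball y r \<subseteq> V" using V yV by (meson open_contains_ball)
        define \<delta> where "\<delta> = min r (\<rho> / 2 * min (1 / (real n + 1)) (min (t - a) (b - t)))"
        have "0 < min (1 / (real n + 1)) (min (t - a) (b - t))" using t by simp
        then have \<delta>: "0 < \<delta>" using r \<rho> by (simp add: \<delta>_def)
        have bound: "\<bar>f (y + h) - f y\<bar> \<le> 2 * real n / \<rho> * norm h" if h: "norm h < \<delta>" "h \<noteq> 0" for h
        proof -
          \<comment> \<open>With this \<open>s\<close> the perturbation \<open>h / s\<close> of \<open>e\<close> has norm \<open>\<rho> / 2\<close>, which keeps it inside the cone.\<close>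
          define s where "s = 2 * norm h / \<rho>"
          have s0: "0 < s" using h \<rho> by (simp add: s_def)
          have "norm h < \<rho> / 2 * min (1 / (real n + 1)) (min (t - a) (b - t))" using h by (simp add: \<delta>_def)
          then have "s < min (1 / (real n + 1)) (min (t - a) (b - t))"
            using \<rho> by (simp add: s_def field_simps del: min_less_iff_conj)
          then have s: "s < 1 / (real n + 1)" "s < t - a" "s < b - t" by auto
          have le: "g (t + s) - g (t - s) \<le> real n * s"
            using no s s0 by (metis diff_gt_0_iff_gt leI less_eq_real_def less_diff_eq add.commute less_diff_eq le_diff_eq)
          have nh: "norm (h /\<^sub>R s) < \<rho>" using s0 h \<rho> by (simp add: s_def field_simps)
          have "y + h \<in> V" using h r by (intro subsetD[OF r(2)]) (simp add: \<delta>_def dist_norm)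
          then have "f (y + h) \<le> f (y + h + s *\<^sub>R (e - h /\<^sub>R s))"
            using nh s0 by (intro mono) (auto simp: e_def)
          also have "y + h + s *\<^sub>R (e - h /\<^sub>R s) = x + (t + s) *\<^sub>R e"
            using s0 by (simp add: y_def algebra_simps)
          finally have up: "f (y + h) \<le> g (t + s)" by (simp add: g_def)
          have tsV: "x + (t - s) *\<^sub>R e \<in> V" using s s0 t by (intro inV) auto
          then have "f (x + (t - s) *\<^sub>R e) \<le> f (x + (t - s) *\<^sub>R e + s *\<^sub>R (e + h /\<^sub>R s))"
            using nh s0 by (intro mono) (auto simp: e_def)
          also have "x + (t - s) *\<^sub>R e + s *\<^sub>R (e + h /\<^sub>R s) = y + h"
            using s0 by (simp add: y_def algebra_simps)
          finally have down: "g (t - s) \<le> f (y + h)" by (simp add: g_def)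
          have "g (t - s) \<le> g t" "g t \<le> g (t + s)" using s s0 t by (auto intro!: step)
          moreover have "f y = g t" by (simp add: g_def y_def)
          ultimately have "\<bar>f (y + h) - f y\<bar> \<le> real n * s" using up down le by linarith
          then show ?thesis by (simp add: s_def mult_ac)
        qed
        obtain N1 :: nat where N1: "2 * real n / \<rho> \<le> real N1" using real_arch_simple by blast
        obtain N2 :: nat where N2: "1 / \<delta> \<le> real N2" using real_arch_simple by blast
        define N where "N = max N1 N2"
        have "1 / \<delta> < real N + 1" using N2 by (simp add: N_def)
        then have "1 / (real N + 1) < \<delta>" using \<delta> by (simp add: field_simps)
        moreover have "2 * real n / \<rho> * norm h \<le> (real N + 1) * norm h" for h :: 'a
          using N1 by (intro mult_right_mono) (auto simp: N_def)
        ultimately have "\<bar>f (y + h) - f y\<bar> \<le> (real N + 1) * norm h" if "norm h < 1 / (real N + 1)" for h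
          using that bound[of h] by (cases "h = 0") (force, meson less_trans order_trans)
        then have "y \<in> lipschitz_points f N" by (simp add: lipschitz_points_def)
        then show False using t by (auto simp: S_def y_def)
      qed
      have "negligible (S \<inter> {a<..<b})"
        by (rule negligible_subset[OF negligible_infinite_derivate_mono[OF gm]]) (use bad in blast)
      moreover have "t0 \<in> {a<..<b}" using \<eta>' by (simp add: a_def b_def)
      ultimately show "\<exists>U. openin (top_of_set S) U \<and> t0 \<in> U \<and> negligible U"
        using t0 by (intro exI[of _ "S \<inter> {a<..<b}"]) (auto intro: openin_open_Int)
    qed
  qed
qed

theorem cone_monotone_gateaux:
  fixes f :: "'a::real_normed_vector \<Rightarrow> real"
  assumes dense: "closure (range d) = UNIV" and V: "open V" and \<rho>: "0 < \<rho>"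
    and mono: "\<And>y u t. y \<in> V \<Longrightarrow> norm (u - d i) < \<rho> \<Longrightarrow> 0 \<le> t \<Longrightarrow> f y \<le> f (y + t *\<^sub>R u)"
  shows "dir_null d {x \<in> V. \<not> (isCont f x \<and> gateaux_differentiable_at f x)}"
proof (rule dir_null_subset)
  have "dir_null d (V - (\<Union>n. lipschitz_points f n))"
    using V \<rho> mono by (rule cone_monotone_lipschitz_points)
  then show "dir_null d ((V - (\<Union>n. lipschitz_points f n)) \<union>
      (\<Union>n. {x \<in> lipschitz_points f n. \<not> gateaux_differentiable_at f x}))"
    by (rule dir_null_Un[OF _ dir_null_UN_nat[OF stepanov_gateaux[OF dense]]])
qed (auto dest: lipschitz_points_isCont)

section \<open>Convex sets that are null along lines\<close>

lemma line_null_at_most_one: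
  assumes "\<And>x s t. x + s *\<^sub>R v \<in> A \<Longrightarrow> x + t *\<^sub>R v \<in> A \<Longrightarrow> s < t \<Longrightarrow> False"
  shows "line_null A v"
  unfolding line_null_def
proof
  fix x
  show "negligible {t. x + t *\<^sub>R v \<in> A}"
  proof (cases "\<exists>t. x + t *\<^sub>R v \<in> A")
    case True
    then obtain t where t: "x + t *\<^sub>R v \<in> A" by blast
    have "{t. x + t *\<^sub>R v \<in> A} \<subseteq> {t}"
    proof
      fix s assume "s \<in> {t. x + t *\<^sub>R v \<in> A}"
      then show "s \<in> {t}" using assms[of x s t] assms[of x t s] t by (cases s t rule: linorder_cases) auto
    qed
    then show ?thesis by (rule negligible_subset[rotated]) simp
  qed simp
qed

definition absolutely_convex :: "'a::real_vector set \<Rightarrow> bool" where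
  "absolutely_convex C \<longleftrightarrow> (\<forall>x\<in>C. \<forall>y\<in>C. \<forall>a b. \<bar>a\<bar> + \<bar>b\<bar> \<le> 1 \<longrightarrow> a *\<^sub>R x + b *\<^sub>R y \<in> C)"

lemma absolutely_convexD:
  "absolutely_convex C \<Longrightarrow> x \<in> C \<Longrightarrow> y \<in> C \<Longrightarrow> \<bar>a\<bar> + \<bar>b\<bar> \<le> 1 \<Longrightarrow> a *\<^sub>R x + b *\<^sub>R y \<in> C"
  unfolding absolutely_convex_def by blast

lemma absolutely_convex_scale:
  "absolutely_convex C \<Longrightarrow> x \<in> C \<Longrightarrow> \<bar>a\<bar> \<le> 1 \<Longrightarrow> a *\<^sub>R x \<in> C"
  using absolutely_convexD[of C x x a 0] by simp

lemma absolutely_convex_imp_convex: "absolutely_convex C \<Longrightarrow> convex C"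
  unfolding convex_def by (auto intro: absolutely_convexD)

lemma absolutely_convex_closure:
  fixes C :: "'a::real_normed_vector set"
  assumes C: "absolutely_convex C"
  shows "absolutely_convex (closure C)"
  unfolding absolutely_convex_def
proof (intro ballI allI impI)
  fix x y :: 'a and a b :: real assume "x \<in> closure C" "y \<in> closure C" and ab: "\<bar>a\<bar> + \<bar>b\<bar> \<le> 1"
  then obtain X Y where X: "\<And>n. X n \<in> C" "X \<longlonglongrightarrow> x" and Y: "\<And>n. Y n \<in> C" "Y \<longlonglongrightarrow> y"
    unfolding closure_sequential by blast
  show "a *\<^sub>R x + b *\<^sub>R y \<in> closure C"
    unfolding closure_sequential using absolutely_convexD[OF C X(1) Y(1) ab]
    by (intro exI[of _ "\<lambda>n. a *\<^sub>R X n + b *\<^sub>R Y n"] conjI allI tendsto_intros X(2) Y(2))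
qed

text \<open>
  For an increasing chain of absolutely convex sets this is the linear hull of the union (or empty, if all
  the sets are).  Only multiples of single members occur, so that the hull of closed sets is visibly
  an \<open>F\<^sub>\<sigma>\<close>.
\<close>

definition linear_hull_of_chain :: "(nat \<Rightarrow> 'a::real_vector set) \<Rightarrow> 'a set" where
  "linear_hull_of_chain C = (\<Union>n. (\<lambda>x. (real n + 1) *\<^sub>R x) ` C n)"

locale absolutely_convex_chain =
  fixes C :: "nat \<Rightarrow> 'a::banach set"
  assumes abs_convex: "absolutely_convex (C n)" and incr: "incseq C" and closed_chain: "closed (C n)"
begin

abbreviation "Y \<equiv> linear_hull_of_chain C"

lemma chain_subset: "C n \<subseteq> Y"
proof
  fix x assume x: "x \<in> C n"
  have "(1 / (real n + 1)) *\<^sub>R x \<in> C n" by (rule absolutely_convex_scale[OF abs_convex x]) simp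
  moreover have "x = (real n + 1) *\<^sub>R ((1 / (real n + 1)) *\<^sub>R x)" by (simp add: add_nonneg_eq_0_iff)
  ultimately show "x \<in> Y" unfolding linear_hull_of_chain_def by blast
qed

lemma hull_combination:
  assumes "x \<in> Y" "y \<in> Y"
  shows "a *\<^sub>R x + b *\<^sub>R y \<in> Y"
proof -
  obtain n c where c: "c \<in> C n" "x = (real n + 1) *\<^sub>R c" using assms by (auto simp: linear_hull_of_chain_def)
  obtain k e where e: "e \<in> C k" "y = (real k + 1) *\<^sub>R e" using assms by (auto simp: linear_hull_of_chain_def)
  define s where "s = a * (real n + 1)"
  define t where "t = b * (real k + 1)"
  obtain N0 :: nat where N0: "\<bar>s\<bar> + \<bar>t\<bar> \<le> real N0" using real_arch_simple by blast
  define N where "N = max N0 (max n k)"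
  have "n \<le> N" "k \<le> N" by (simp_all add: N_def)
  then have "c \<in> C N" "e \<in> C N" using incseqD[OF incr] c(1) e(1) by blast+
  moreover have "\<bar>s / (real N + 1)\<bar> + \<bar>t / (real N + 1)\<bar> \<le> 1"
  proof -
    have "\<bar>s / (real N + 1)\<bar> + \<bar>t / (real N + 1)\<bar> = (\<bar>s\<bar> + \<bar>t\<bar>) / (real N + 1)"
      by (simp add: abs_divide add_divide_distrib)
    also have "\<dots> \<le> 1" using N0 by (simp add: N_def divide_le_eq)
    finally show ?thesis .
  qed
  ultimately have "(s / (real N + 1)) *\<^sub>R c + (t / (real N + 1)) *\<^sub>R e \<in> C N"
    by (rule absolutely_convexD[OF abs_convex])
  moreover have "a *\<^sub>R x + b *\<^sub>R y = (real N + 1) *\<^sub>R ((s / (real N + 1)) *\<^sub>R c + (t / (real N + 1)) *\<^sub>R e)"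
    unfolding c(2) e(2) s_def t_def scaleR_right_distrib scaleR_scaleR by (simp add: add_nonneg_eq_0_iff)
  ultimately show ?thesis unfolding linear_hull_of_chain_def by blast
qed

lemma closed_scaled: "closed ((\<lambda>x. (real n + 1) *\<^sub>R x) ` C n)"
  by (rule closed_scaling[OF closed_chain])

lemma borel_hull: "Y \<in> sets borel"
  unfolding linear_hull_of_chain_def using closed_scaled by (intro sets.countable_UN) (auto intro: borel_closed)

lemma line_null_hull:
  assumes v: "v \<notin> Y"
  shows "line_null Y v"
proof (rule line_null_at_most_one)
  fix x s t assume "x + s *\<^sub>R v \<in> Y" "x + t *\<^sub>R v \<in> Y" "s < (t::real)"
  then have "(- 1 / (t - s)) *\<^sub>R (x + s *\<^sub>R v) + (1 / (t - s)) *\<^sub>R (x + t *\<^sub>R v) \<in> Y"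
    by (intro hull_combination)
  also have "(- 1 / (t - s)) *\<^sub>R (x + s *\<^sub>R v) + (1 / (t - s)) *\<^sub>R (x + t *\<^sub>R v) = (1 / (t - s)) *\<^sub>R ((t - s) *\<^sub>R v)"
    by (simp add: algebra_simps)
  also have "\<dots> = v" using \<open>s < t\<close> by simp
  finally show False using v by simp
qed

text \<open>
  Baire's theorem, applied to the dilated sets.
\<close>

lemma hull_proper:
  assumes thin: "\<And>n. interior (C n) = {}"
  shows "\<exists>v. v \<notin> Y"
proof -
  define G where "G = range (\<lambda>n. (\<lambda>x. (real n + 1) *\<^sub>R x) ` C n)"
  have "Met_TC.mtopology interior_of \<Union>G = {}"
  proof (rule Met_TC.metric_Baire_category_alt)
    show "Met_TC.mcomplete TYPE('a)"
      unfolding Met_TC.mcomplete_def using Cauchy_convergent by (auto simp: convergent_def)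
    show "countable G" by (simp add: G_def)
    fix T assume "T \<in> G"
    then obtain n where T: "T = (\<lambda>x. (real n + 1) *\<^sub>R x) ` C n" by (auto simp: G_def)
    have "interior T = {}"
    proof (rule ccontr)
      assume "interior T \<noteq> {}"
      then obtain z where z: "z \<in> interior T" by blast
      let ?U = "(\<lambda>x. (real n + 1) *\<^sub>R x) -` interior T"
      have "open ?U" by (intro open_vimage open_interior continuous_intros)
      moreover have "?U \<subseteq> C n"
      proof
        fix x assume "x \<in> ?U"
        then have "(real n + 1) *\<^sub>R x \<in> T" using interior_subset by auto
        then obtain y where "y \<in> C n" "(real n + 1) *\<^sub>R x = (real n + 1) *\<^sub>R y" unfolding T by auto
        then show "x \<in> C n" by (simp add: add_nonneg_eq_0_iff)
      qed
      moreover have "(1 / (real n + 1)) *\<^sub>R z \<in> ?U" using z by (simp add: add_nonneg_eq_0_iff)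
      ultimately have "(1 / (real n + 1)) *\<^sub>R z \<in> interior (C n)" by (meson interiorI)
      then show False using thin by simp
    qed
    then show "closedin Met_TC.mtopology T \<and> Met_TC.mtopology interior_of T = {}"
      using closed_scaled[of n] by (simp add: T)
  qed
  then have "interior Y = {}" by (simp add: G_def linear_hull_of_chain_def)
  then have "Y \<noteq> UNIV" by (metis UNIV_not_empty interior_UNIV)
  then show ?thesis by blast
qed

end

text \<open>
  Near a boundary point \<open>y\<close>, a move in a direction close to \<open>y\<close> leaves \<open>K\<close>: otherwise \<open>y\<close> would lie between
  a point of \<open>K\<close> and a point of the ball around \<open>0\<close>, hence be interior.  So a line in the
  direction \<open>d i\<close> meets the part of the boundary near \<open>d i\<close> at most once.
\<close>

lemma convex_boundary_dir_null:
  fixes K :: "'a::real_normed_vector set"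
  assumes dense: "closure (range d) = UNIV" and K: "convex K" "closed K" and r: "0 < r" "ball 0 r \<subseteq> K"
  shows "dir_null d (K - interior K)"
proof -
  define A where "A i = (K - interior K) \<inter> ball (d i) r" for i
  have "dir_null d (A i)" for i
  proof (rule dir_null_single)
    show "A i \<in> sets borel" unfolding A_def using K by (intro sets.Int sets.Diff) auto
    show "line_null (A i) (d i)"
    proof (rule line_null_at_most_one)
      fix x and s s' :: real assume s: "x + s *\<^sub>R d i \<in> A i" "x + s' *\<^sub>R d i \<in> A i" "s < s'"
      define y where "y = x + s *\<^sub>R d i"
      define t where "t = s' - s"
      have t: "0 < t" using s by (simp add: t_def)
      define z where "z = y + t *\<^sub>R d i"
      have z: "z \<in> K" using s(2) by (simp add: A_def y_def z_def t_def algebra_simps)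
      have y: "y \<in> K" "y \<notin> interior K" "dist (d i) y < r" using s(1) by (auto simp: A_def y_def)
      define \<epsilon> where "\<epsilon> = (r - dist (d i) y) * t / (1 + t)"
      have "ball y \<epsilon> \<subseteq> K"
      proof
        fix w assume "w \<in> ball y \<epsilon>"
        then have w: "norm (w - y) < \<epsilon>" by (simp add: dist_norm norm_minus_commute)
        have cancel: "M / t * (k * t / M) = k" if "0 < M" for M k using t that by simp
        \<comment> \<open>The point \<open>b\<close> of the ball around \<open>0\<close> for which \<open>w\<close> lies on the segment from \<open>z\<close> to \<open>b\<close>.\<close>
        define b where "b = (y - d i) + ((1 + t) / t) *\<^sub>R (w - y)"
        have "norm b \<le> norm (y - d i) + (1 + t) / t * norm (w - y)"
          unfolding b_def using t by (intro order_trans[OF norm_triangle_ineq]) simp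
        also have "\<dots> < norm (y - d i) + (1 + t) / t * \<epsilon>"
          using w t by (intro add_strict_left_mono mult_strict_left_mono) auto
        also have "(1 + t) / t * \<epsilon> = r - dist (d i) y"
          using t cancel[of "1 + t"] by (simp only: \<epsilon>_def)
        finally have "b \<in> K" using r by (auto simp: dist_norm norm_minus_commute)
        then have "(1 / (1 + t)) *\<^sub>R z + (t / (1 + t)) *\<^sub>R b \<in> K"
          using t z K(1) by (intro convexD) (auto simp flip: add_divide_distrib)
        also have "(1 / (1 + t)) *\<^sub>R z + (t / (1 + t)) *\<^sub>R b = (1 / (1 + t)) *\<^sub>R (z + t *\<^sub>R b)"
          by (simp add: scaleR_right_distrib)
        also have "t *\<^sub>R b = t *\<^sub>R (y - d i) + (1 + t) *\<^sub>R (w - y)"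
          using t by (simp add: b_def scaleR_right_distrib)
        also have "z + (t *\<^sub>R (y - d i) + (1 + t) *\<^sub>R (w - y)) = (1 + t) *\<^sub>R w"
          by (simp add: z_def algebra_simps)
        also have "(1 / (1 + t)) *\<^sub>R ((1 + t) *\<^sub>R w) = w" using t by simp
        finally show "w \<in> K" .
      qed
      moreover have "0 < \<epsilon>" using y t by (simp add: \<epsilon>_def)
      ultimately have "y \<in> interior K" by (auto simp: mem_interior)
      then show False using y by simp
    qed
  qed
  then have "dir_null d (\<Union>i. A i)" by (rule dir_null_UN_nat)
  moreover have "K - interior K \<subseteq> (\<Union>i. A i)"
  proof
    fix x assume x: "x \<in> K - interior K"
    have "x \<in> closure (range d)" using dense by simp
    then show "x \<in> (\<Union>i. A i)" using x r(1) unfolding closure_approachable by (auto simp: A_def)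
  qed
  ultimately show ?thesis by (rule dir_null_subset)
qed

text \<open>
  Move slightly beyond \<open>x\<close>, away from \<open>0\<close>, and then to a nearby point of \<open>S\<close>; \<open>x\<close> lies between this point and
  a point of the ball around \<open>0\<close>.
\<close>

lemma interior_closure_convex_subset:
  fixes S :: "'a::real_normed_vector set"
  assumes S: "convex S" and r: "0 < r" "ball 0 r \<subseteq> S" and x: "x \<in> interior (closure S)"
  shows "x \<in> S"
proof -
  obtain e where e: "0 < e" "ball x e \<subseteq> closure S" using x by (auto simp: mem_interior)
  define \<epsilon> where "\<epsilon> = e / (2 * (norm x + 1))"
  have nx: "0 < norm x + 1" by (simp add: add_nonneg_pos)
  have \<epsilon>: "0 < \<epsilon>" using e nx by (simp add: \<epsilon>_def)
  have "\<epsilon> * norm x \<le> \<epsilon> * (norm x + 1)" using \<epsilon> by simp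
  also have "\<dots> = e / 2" using nx by (simp add: \<epsilon>_def field_simps)
  finally have "\<epsilon> * norm x < e" using e by simp
  then have "x + \<epsilon> *\<^sub>R x \<in> closure S" using e \<epsilon> by (intro subsetD[OF e(2)]) (simp add: dist_norm)
  then obtain s where s: "s \<in> S" "dist s (x + \<epsilon> *\<^sub>R x) < \<epsilon> * r"
    using \<epsilon> r unfolding closure_approachable by (meson mult_pos_pos)
  define b where "b = (1 / \<epsilon>) *\<^sub>R (x + \<epsilon> *\<^sub>R x - s)"
  have "norm b = dist s (x + \<epsilon> *\<^sub>R x) / \<epsilon>"
    using \<epsilon> by (simp add: b_def dist_norm norm_minus_commute)
  then have "norm b < r" using s(2) \<epsilon> by (simp add: pos_divide_less_eq mult.commute)
  then have "b \<in> S" using r by (auto simp: dist_norm)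
  then have "(1 / (1 + \<epsilon>)) *\<^sub>R s + (\<epsilon> / (1 + \<epsilon>)) *\<^sub>R b \<in> S"
    using s \<epsilon> S by (intro convexD) (auto simp flip: add_divide_distrib)
  also have "(1 / (1 + \<epsilon>)) *\<^sub>R s + (\<epsilon> / (1 + \<epsilon>)) *\<^sub>R b = (1 / (1 + \<epsilon>)) *\<^sub>R (s + \<epsilon> *\<^sub>R b)"
    by (simp add: scaleR_right_distrib)
  also have "s + \<epsilon> *\<^sub>R b = (1 + \<epsilon>) *\<^sub>R x" using \<epsilon> by (simp add: b_def algebra_simps)
  also have "(1 / (1 + \<epsilon>)) *\<^sub>R ((1 + \<epsilon>) *\<^sub>R x) = x" using \<epsilon> by simp
  finally show ?thesis .
qed

section \<open>Even quasiconvex functions\<close>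

text \<open>
  The level \<open>m\<close> of the introduction is \<open>threshold\<close>, the set \<open>C\<close> is \<open>core\<close>, and \<open>deep\<close> is the chain of the
  closed sublevel sets below \<open>m\<close> whose hull is \<open>Y\<close>.
\<close>

locale even_quasiconvex =
  fixes f :: "'a::banach \<Rightarrow> real"
  assumes even: "even_function f" and qc: "quasiconvex f" and dc: "densely_continuous f"
begin

definition sublevel :: "real \<Rightarrow> 'a set" where
  "sublevel \<alpha> = {x. f x < \<alpha>}"

definition threshold :: real where
  "threshold = Inf (f ` {x. isCont f x})"

definition bad_points :: "'a set" where
  "bad_points = {x. \<not> (isCont f x \<and> gateaux_differentiable_at f x)}"

lemma f_neg: "f (- x) = f x"
  using even by (simp add: even_function_def)

lemma f_segment: "0 \<le> l \<Longrightarrow> l \<le> 1 \<Longrightarrow> f (l *\<^sub>R x + (1 - l) *\<^sub>R y) \<le> max (f x) (f y)"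
  using qc by (simp add: quasiconvex_def)

lemma f_zero_le: "f 0 \<le> f x"
  using f_segment[of "1/2" x "- x"] by (simp add: f_neg)

lemma continuity_dense: "closure {x. isCont f x} = UNIV"
proof -
  obtain D where "closure D = UNIV" "\<forall>x\<in>D. isCont f x"
    using dc unfolding densely_continuous_def holds_densely_def by blast
  then show ?thesis using closure_mono[of D "{x. isCont f x}"] by auto
qed

lemma continuity_nonempty: "{x. isCont f x} \<noteq> {}"
  using continuity_dense by (metis closure_empty UNIV_not_empty)

lemma threshold_le: "isCont f x \<Longrightarrow> threshold \<le> f x"
  unfolding threshold_def using f_zero_le
  by (intro cInf_lower) (auto intro!: bdd_belowI[of _ "f 0"])

lemma absolutely_convex_sublevel: "absolutely_convex (sublevel \<alpha>)"
  unfolding absolutely_convex_def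
proof (intro ballI allI impI)
  fix x y a b assume xy: "x \<in> sublevel \<alpha>" "y \<in> sublevel \<alpha>" and ab: "\<bar>a\<bar> + \<bar>b\<bar> \<le> (1::real)"
  have scale: "f (c *\<^sub>R z) \<le> f z" if "\<bar>c\<bar> \<le> 1" for c z
  proof -
    have "c *\<^sub>R z = ((1 + c) / 2) *\<^sub>R z + (1 - (1 + c) / 2) *\<^sub>R (- z)"
      by (simp flip: scaleR_left_diff_distrib)
    moreover have "f (((1 + c) / 2) *\<^sub>R z + (1 - (1 + c) / 2) *\<^sub>R (- z)) \<le> max (f z) (f (- z))"
      using that by (intro f_segment) (auto simp: abs_le_iff)
    ultimately show ?thesis by (simp add: f_neg)
  qed
  show "a *\<^sub>R x + b *\<^sub>R y \<in> sublevel \<alpha>"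
  proof (cases "\<bar>a\<bar> + \<bar>b\<bar> = 0")
    case True
    then have "a = 0" "b = 0" by auto
    then have "f (a *\<^sub>R x + b *\<^sub>R y) \<le> f x" using f_zero_le by simp
    then show ?thesis using xy by (simp add: sublevel_def)
  next
    case False
    define q where "q = \<bar>a\<bar> + \<bar>b\<bar>"
    have q: "0 < q" using False by (simp add: q_def)
    have "f (a *\<^sub>R x + b *\<^sub>R y) = f (q *\<^sub>R ((\<bar>a\<bar> / q) *\<^sub>R (sgn a *\<^sub>R x) + (1 - \<bar>a\<bar> / q) *\<^sub>R (sgn b *\<^sub>R y)))"
    proof -
      have "1 - \<bar>a\<bar> / q = \<bar>b\<bar> / q" using q by (simp add: field_simps) (simp add: q_def)
      then have "q *\<^sub>R ((\<bar>a\<bar> / q) *\<^sub>R (sgn a *\<^sub>R x) + (1 - \<bar>a\<bar> / q) *\<^sub>R (sgn b *\<^sub>R y)) = (\<bar>a\<bar> * sgn a) *\<^sub>R x + (\<bar>b\<bar> * sgn b) *\<^sub>R y"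
        using q by (simp add: scaleR_right_distrib)
      then show ?thesis by (simp add: abs_mult_sgn)
    qed
    also have "\<dots> \<le> f ((\<bar>a\<bar> / q) *\<^sub>R (sgn a *\<^sub>R x) + (1 - \<bar>a\<bar> / q) *\<^sub>R (sgn b *\<^sub>R y))"
      using ab by (intro scale) (simp add: q_def)
    also have "\<dots> \<le> max (f (sgn a *\<^sub>R x)) (f (sgn b *\<^sub>R y))"
      using q by (intro f_segment) (auto simp: q_def)
    also have "\<dots> \<le> max (f x) (f y)"
      by (intro max.mono scale) (auto simp: abs_sgn_eq)
    finally show ?thesis using xy by (auto simp: sublevel_def)
  qed
qed

text \<open>
  A point of continuity with a value below \<open>\<alpha>\<close> is interior to the sublevel set; averaging with the
  reflected set moves the ball to \<open>0\<close>.
\<close>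

lemma sublevel_ball:
  assumes "threshold < \<alpha>"
  shows "\<exists>r>0. ball 0 r \<subseteq> sublevel \<alpha>"
proof -
  obtain z where z: "isCont f z" "f z < \<alpha>"
    using assms cInf_lessD[of "f ` {x. isCont f x}" \<alpha>] continuity_nonempty by (auto simp: threshold_def)
  have "\<forall>\<^sub>F y in nhds z. f y < \<alpha>"
    using z by (intro order_tendstoD(2)) (auto simp: continuous_at tendsto_at_iff_tendsto_nhds)
  then obtain r where r: "0 < r" "\<And>y. dist y z < r \<Longrightarrow> f y < \<alpha>" unfolding eventually_nhds_metric by blast
  have "ball 0 r \<subseteq> sublevel \<alpha>"
  proof
    fix w :: 'a assume w: "w \<in> ball 0 r"
    have "z + w \<in> sublevel \<alpha>" "z - w \<in> sublevel \<alpha>" using r(2)[of "z + w"] r(2)[of "z - w"] w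
      by (auto simp: sublevel_def dist_norm)
    then have "(1/2) *\<^sub>R (z + w) + (- 1/2) *\<^sub>R (z - w) \<in> sublevel \<alpha>"
      by (rule absolutely_convexD[OF absolutely_convex_sublevel]) simp
    also have "(1/2) *\<^sub>R (z + w) + (- 1/2) *\<^sub>R (z - w) = w"
      by (simp add: algebra_simps flip: scaleR_left_distrib)
    finally show "w \<in> sublevel \<alpha>" .
  qed
  then show ?thesis using r(1) by blast
qed

lemma sublevel_nowhere_dense:
  assumes "\<alpha> < threshold"
  shows "interior (closure (sublevel \<alpha>)) = {}"
proof (rule ccontr)
  let ?I = "interior (closure (sublevel \<alpha>))"
  assume "?I \<noteq> {}"
  then have "?I \<inter> {x. isCont f x} \<noteq> {}"
    using continuity_dense open_Int_closure_eq_empty[OF open_interior, of "closure (sublevel \<alpha>)" "{x. isCont f x}"] by auto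
  then obtain x where x: "x \<in> ?I" "isCont f x" by blast
  have "\<alpha> < f x" using threshold_le[OF x(2)] assms by simp
  then have "\<forall>\<^sub>F y in nhds x. \<alpha> < f y"
    using x by (intro order_tendstoD(1)) (auto simp: continuous_at tendsto_at_iff_tendsto_nhds)
  then obtain r where r: "0 < r" "\<And>y. dist y x < r \<Longrightarrow> \<alpha> < f y" unfolding eventually_nhds_metric by blast
  have "x \<in> closure (sublevel \<alpha>)" using x interior_subset by blast
  then obtain y where "y \<in> sublevel \<alpha>" "dist y x < r" using r(1) unfolding closure_approachable by blast
  then show False using r(2)[of y] by (simp add: sublevel_def)
qed

text \<open>
  Let \<open>y\<close> be outside the closed sublevel set and \<open>u\<close> close to \<open>y\<close>.  Then \<open>y\<close> lies between \<open>y - u\<close>, a point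
  of the ball around \<open>0\<close> with \<open>f (y - u) < \<alpha> \<le> f y\<close>, and \<open>y + t u\<close>; so quasiconvexity gives
  \<open>f y \<le> f (y + t u)\<close>.  Near each \<open>d i\<close> the function is therefore monotone along the cone of
  directions close to \<open>d i\<close>.
\<close>

lemma outside_sublevel_dir_null:
  assumes dense: "closure (range d) = UNIV" and \<alpha>: "threshold < \<alpha>"
  shows "dir_null d (bad_points - closure (sublevel \<alpha>))"
proof -
  obtain r where r: "0 < r" "ball 0 r \<subseteq> sublevel \<alpha>" using sublevel_ball[OF \<alpha>] by blast
  define V where "V i = ball (d i) (r / 2) - closure (sublevel \<alpha>)" for i
  have "dir_null d {x \<in> V i. \<not> (isCont f x \<and> gateaux_differentiable_at f x)}" for i
  proof (rule cone_monotone_gateaux[OF dense])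
    show "open (V i)" unfolding V_def by (intro open_Diff) auto
    show "0 < r / 2" using r by simp
    fix y u :: 'a and t :: real assume y: "y \<in> V i" and u: "norm (u - d i) < r / 2" and t: "0 \<le> t"
    have "y \<notin> sublevel \<alpha>" using y closure_subset[of "sublevel \<alpha>"] by (auto simp: V_def)
    then have "\<alpha> \<le> f y" by (simp add: sublevel_def not_less)
    have "norm (y - u) \<le> norm (y - d i) + norm (d i - u)"
      using norm_triangle_ineq[of "y - d i" "d i - u"] by simp
    also have "\<dots> < r" using y u by (simp add: V_def dist_norm norm_minus_commute)
    finally have "f (y - u) < \<alpha>" using r(2) by (auto simp: sublevel_def dist_norm)
    have "y = (1 / (1 + t)) *\<^sub>R ((1 + t) *\<^sub>R y)" using t by simp
    also have "(1 + t) *\<^sub>R y = (y + t *\<^sub>R u) + t *\<^sub>R (y - u)" by (simp add: algebra_simps)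
    also have "(1 / (1 + t)) *\<^sub>R ((y + t *\<^sub>R u) + t *\<^sub>R (y - u)) =
        (1 / (1 + t)) *\<^sub>R (y + t *\<^sub>R u) + (1 - 1 / (1 + t)) *\<^sub>R (y - u)"
    proof -
      have "1 - 1 / (1 + t) = 1 / (1 + t) * t" using t by (simp add: field_simps)
      then show ?thesis by (simp only: scaleR_right_distrib[of "1 / (1 + t)" "y + t *\<^sub>R u"] scaleR_scaleR)
    qed
    finally have "f y \<le> max (f (y + t *\<^sub>R u)) (f (y - u))"
      using f_segment[of "1 / (1 + t)" "y + t *\<^sub>R u" "y - u"] t by simp
    then show "f y \<le> f (y + t *\<^sub>R u)" using \<open>\<alpha> \<le> f y\<close> \<open>f (y - u) < \<alpha>\<close> by auto
  qed
  then have "dir_null d (\<Union>i. {x \<in> V i. \<not> (isCont f x \<and> gateaux_differentiable_at f x)})"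
    by (rule dir_null_UN_nat)
  moreover have "\<exists>i. x \<in> ball (d i) (r / 2)" for x
  proof -
    have "x \<in> closure (range d)" "0 < r / 2" using dense r(1) by auto
    then obtain y where "y \<in> range d" "dist y x < r / 2" unfolding closure_approachable by blast
    then show ?thesis by auto
  qed
  ultimately show ?thesis by (elim dir_null_subset) (auto simp: V_def bad_points_def)
qed

definition core :: "'a set" where
  "core = (\<Inter>n::nat. closure (sublevel (threshold + 1 / (real n + 1))))"

lemma core_closed: "closed core"
  by (auto simp: core_def)

lemma core_absolutely_convex: "absolutely_convex core"
  using absolutely_convex_closure[OF absolutely_convex_sublevel]
  unfolding core_def absolutely_convex_def[of "\<Inter>n. _ n"] by (auto intro: absolutely_convexD)

lemma outside_core_dir_null:
  assumes dense: "closure (range d) = UNIV"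
  shows "dir_null d (bad_points - core)"
proof -
  have "dir_null d (\<Union>n::nat. bad_points - closure (sublevel (threshold + 1 / (real n + 1))))"
    by (intro dir_null_UN_nat outside_sublevel_dir_null[OF dense]) simp
  then show ?thesis by (rule dir_null_subset) (auto simp: core_def)
qed

text \<open>
  Each sublevel set above the threshold is convex with interior points, so it contains the
  interior of its closure.
\<close>

lemma le_threshold_on_interior_core:
  assumes x: "x \<in> interior core"
  shows "f x \<le> threshold"
proof (rule field_le_epsilon)
  fix e :: real assume "0 < e"
  then obtain n :: nat where n: "1 / (real n + 1) < e"
    by (blast dest: ex_inverse_nat_less)
  let ?S = "sublevel (threshold + 1 / (real n + 1))"
  obtain r where r: "0 < r" "ball 0 r \<subseteq> ?S" using sublevel_ball[of "threshold + 1 / (real n + 1)"] by auto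
  have "core \<subseteq> closure ?S" by (auto simp: core_def)
  then have "x \<in> interior (closure ?S)" using x interior_mono by blast
  then have "x \<in> ?S"
    using interior_closure_convex_subset[OF absolutely_convex_imp_convex[OF absolutely_convex_sublevel] r] by blast
  then show "f x \<le> threshold + e" using n by (simp add: sublevel_def)
qed

definition deep :: "nat \<Rightarrow> 'a set" where
  "deep n = closure (sublevel (threshold - 1 / (real n + 1)))"

lemma deep_chain: "absolutely_convex_chain deep"
proof
  fix n
  show "absolutely_convex (deep n)" unfolding deep_def
    by (rule absolutely_convex_closure[OF absolutely_convex_sublevel])
  show "closed (deep n)" by (simp add: deep_def)
  show "incseq deep"
  proof (rule incseq_SucI)
    fix n
    have "1 / (real (Suc n) + 1) \<le> 1 / (real n + 1)" by (simp add: frac_le)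
    then show "deep n \<subseteq> deep (Suc n)" unfolding deep_def sublevel_def by (intro closure_mono) auto
  qed
qed

text \<open>
  In the interior of the core, \<open>f\<close> equals the threshold outside the hull of the deep sets.  A line through \<open>x\<close> meets the hull
  at most once, for otherwise it would lie in the hull together with \<open>x\<close>; hence \<open>f\<close> is constant on the
  line near \<open>x\<close>.
\<close>

lemma good_on_interior_core:
  assumes x: "x \<in> interior core" "x \<notin> linear_hull_of_chain deep"
  shows "x \<notin> bad_points"
proof -
  interpret absolutely_convex_chain deep by (rule deep_chain)
  have not_deep: "threshold - 1 / (real n + 1) \<le> f y" if "y \<notin> deep n" for y n
  proof -
    have "y \<notin> sublevel (threshold - 1 / (real n + 1))" using that closure_subset by (auto simp: deep_def)
    then show ?thesis by (simp add: sublevel_def not_less)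
  qed
  have eq: "f y = threshold" if y: "y \<in> interior core" "y \<notin> linear_hull_of_chain deep" for y
  proof (rule antisym)
    show "f y \<le> threshold" by (rule le_threshold_on_interior_core[OF y(1)])
    show "threshold \<le> f y"
    proof (rule field_le_epsilon)
      fix e :: real assume "0 < e"
      then obtain n :: nat where n: "1 / (real n + 1) < e" using ex_inverse_nat_less by blast
      have "y \<notin> deep n" using y(2) chain_subset by blast
      then show "threshold \<le> f y + e" using not_deep[of y n] n by linarith
    qed
  qed
  have "isCont f x" unfolding continuous_at
  proof (rule tendstoI)
    fix e :: real assume "0 < e"
    then obtain n :: nat where n: "1 / (real n + 1) < e" using ex_inverse_nat_less by blast
    have "open (interior core - deep n)" by (intro open_Diff) (auto simp: deep_def)
    moreover have "x \<in> interior core - deep n" using x chain_subset by blast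
    ultimately have "\<forall>\<^sub>F y in at x. y \<in> interior core - deep n" by (rule eventually_at_in_open')
    then show "\<forall>\<^sub>F y in at x. dist (f y) (f x) < e"
    proof (rule eventually_mono)
      fix y assume y: "y \<in> interior core - deep n"
      then show "dist (f y) (f x) < e"
        using eq[OF x] le_threshold_on_interior_core[of y] not_deep[of y n] n
        by (simp add: dist_real_def abs_less_iff)
    qed
  qed
  moreover have "has_dir_deriv f x h 0" for h
  proof -
    obtain r0 where r0: "0 < r0" "\<And>t. \<bar>t\<bar> < r0 \<Longrightarrow> x + t *\<^sub>R h \<in> interior core"
      using eventually_line_in_open[OF open_interior x(1), of h] unfolding eventually_nhds_metric
      by (auto simp: dist_real_def)
    have one: "s = t" if "x + s *\<^sub>R h \<in> Y" "x + t *\<^sub>R h \<in> Y" for s t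
    proof (rule ccontr)
      assume "s \<noteq> t"
      have "(t / (t - s)) *\<^sub>R (x + s *\<^sub>R h) + (- s / (t - s)) *\<^sub>R (x + t *\<^sub>R h) \<in> Y"
        by (rule hull_combination[OF that])
      also have "(t / (t - s)) *\<^sub>R (x + s *\<^sub>R h) + (- s / (t - s)) *\<^sub>R (x + t *\<^sub>R h) =
          (1 / (t - s)) *\<^sub>R (t *\<^sub>R (x + s *\<^sub>R h) - s *\<^sub>R (x + t *\<^sub>R h))"
        by (simp add: scaleR_right_diff_distrib)
      also have "t *\<^sub>R (x + s *\<^sub>R h) - s *\<^sub>R (x + t *\<^sub>R h) = (t - s) *\<^sub>R x" by (simp add: algebra_simps)
      also have "(1 / (t - s)) *\<^sub>R ((t - s) *\<^sub>R x) = x" using \<open>s \<noteq> t\<close> by simp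
      finally show False using x(2) by simp
    qed
    obtain r1 where r1: "0 < r1" "\<And>t. \<bar>t\<bar> < r1 \<Longrightarrow> x + t *\<^sub>R h \<notin> Y"
    proof (cases "\<exists>t. x + t *\<^sub>R h \<in> Y")
      case True
      then obtain t1 where t1: "x + t1 *\<^sub>R h \<in> Y" by blast
      then have "t1 \<noteq> 0" using x(2) by auto
      moreover have "x + t *\<^sub>R h \<notin> Y" if "\<bar>t\<bar> < \<bar>t1\<bar>" for t
        using one[OF _ t1, of t] that by blast
      ultimately show ?thesis using that[of "\<bar>t1\<bar>"] by simp
    qed (use that[of 1] in auto)
    have const: "f (x + t *\<^sub>R h) = f x" if "\<bar>t\<bar> < min r0 r1" for t
      using eq[OF x] eq[of "x + t *\<^sub>R h"] r0(2)[of t] r1(2)[of t] that by simp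
    show ?thesis unfolding has_dir_deriv_iff
    proof (intro allI impI)
      fix e :: real assume "0 < e"
      then show "\<exists>r>0. \<forall>t. \<bar>t\<bar> < r \<longrightarrow> \<bar>f (x + t *\<^sub>R h) - f x - t * 0\<bar> \<le> e * \<bar>t\<bar>"
        using const r0(1) r1(1) by (intro exI[of _ "min r0 r1"]) auto
    qed
  qed
  then have "has_gateaux_derivative f 0 x" by (simp add: has_gateaux_derivative_iff_dir)
  ultimately show ?thesis unfolding bad_points_def gateaux_differentiable_at_def by blast
qed

text \<open>
  The exceptional subspace is the hull of the core or that of the deep sets, according to whether the core has
  empty interior.  A direction \<open>v\<close> outside it is put in front of the dense sequence.
\<close>

lemma bad_points_dir_null:
  fixes q :: "nat \<Rightarrow> 'a"
  assumes dense: "closure (range q) = UNIV"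
  shows "\<exists>d. dir_null d bad_points"
proof -
  have dense': "closure (range (case_nat v q)) = UNIV" for v
  proof -
    have "range q \<subseteq> range (case_nat v q)"
    proof
      fix y assume "y \<in> range q"
      then obtain n where "y = case_nat v q (Suc n)" by auto
      then show "y \<in> range (case_nat v q)" by blast
    qed
    then show ?thesis using closure_mono dense by blast
  qed
  show ?thesis
  proof (cases "interior core = {}")
    case True
    interpret absolutely_convex_chain "\<lambda>_. core"
      by standard (auto simp: core_absolutely_convex core_closed incseq_def)
    obtain v where v: "v \<notin> Y" using hull_proper True by blast
    have "dir_null (case_nat v q) Y"
      by (rule dir_null_single[OF borel_hull, where i = 0]) (simp add: line_null_hull[OF v])
    then have "dir_null (case_nat v q) ((bad_points - core) \<union> Y)"
      by (intro dir_null_Un outside_core_dir_null[OF dense'])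
    then have "dir_null (case_nat v q) bad_points"
      by (rule dir_null_subset) (use chain_subset in auto)
    then show ?thesis by blast
  next
    case False
    interpret absolutely_convex_chain deep by (rule deep_chain)
    have "interior (deep n) = {}" for n
      unfolding deep_def by (rule sublevel_nowhere_dense) simp
    then obtain v where v: "v \<notin> Y" using hull_proper by blast
    obtain z e where z: "0 < e" "ball z e \<subseteq> core" using False by (auto simp: mem_interior)
    have "ball 0 e \<subseteq> core"
    proof
      fix w :: 'a assume w: "w \<in> ball 0 e"
      then have "z + w \<in> core" "z - w \<in> core" using z by (auto simp: dist_norm)
      then have "(1/2) *\<^sub>R (z + w) + (- 1/2) *\<^sub>R (z - w) \<in> core"
        by (rule absolutely_convexD[OF core_absolutely_convex]) simp
      also have "(1/2) *\<^sub>R (z + w) + (- 1/2) *\<^sub>R (z - w) = w"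
        by (simp add: algebra_simps flip: scaleR_left_distrib)
      finally show "w \<in> core" .
    qed
    then have "dir_null (case_nat v q) (core - interior core)"
      by (rule convex_boundary_dir_null[OF dense' absolutely_convex_imp_convex[OF core_absolutely_convex] core_closed z(1)])
    moreover have "dir_null (case_nat v q) Y"
      by (rule dir_null_single[OF borel_hull, where i = 0]) (simp add: line_null_hull[OF v])
    ultimately have "dir_null (case_nat v q) ((bad_points - core) \<union> ((core - interior core) \<union> Y))"
      by (intro dir_null_Un outside_core_dir_null[OF dense'])
    then have "dir_null (case_nat v q) bad_points"
      by (rule dir_null_subset) (use good_on_interior_core in auto)
    then show ?thesis by blast
  qed
qed

end

theorem corollary6p5:
  fixes f :: "'a::banach \<Rightarrow> real"
  assumes "separable_space (euclidean :: 'a topology)"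
    and "even_function f"
    and "quasiconvex f"
    and "densely_continuous f"
  shows "holds_densely (\<lambda>x. isCont f x \<and> gateaux_differentiable_at f x) \<and>
    (reflexive_space TYPE('a) \<longrightarrow>
      holds_except_haar_null (\<lambda>x. isCont f x \<and> gateaux_differentiable_at f x))"
proof -
  interpret even_quasiconvex f using assms(2-4) by unfold_locales
  obtain D :: "'a set" where D: "countable D" "closure D = UNIV"
    using assms(1) unfolding separable_space_def by (auto simp: closure_of_eq)
  then have "D \<noteq> {}" by auto
  then have "closure (range (from_nat_into D)) = UNIV" using D by (simp add: range_from_nat_into)
  then obtain d where "dir_null d bad_points" using bad_points_dir_null by blast
  then obtain E where E: "haar_null E" "bad_points \<subseteq> E" using dir_null_imp_haar_null by blast
  have good: "isCont f x \<and> gateaux_differentiable_at f x" if "x \<notin> E" for x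
    using that E(2) by (auto simp: bad_points_def)
  have "closure (- E) = UNIV" by (rule haar_null_complement_dense[OF assms(1) E(1)])
  then have "holds_densely (\<lambda>x. isCont f x \<and> gateaux_differentiable_at f x)"
    unfolding holds_densely_def using good by blast
  moreover have "holds_except_haar_null (\<lambda>x. isCont f x \<and> gateaux_differentiable_at f x)"
    unfolding holds_except_haar_null_def using E(1) good by blast
  ultimately show ?thesis by blast
qed

end
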